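(* Let $\alpha_1,\beta_1,\gamma_1,\delta_1\in\mathbb{R}$ and define, for $x\in\left(0,\frac{\pi}{2}\right]$, $$f_1(x)=\left(1-\frac{4(\pi-2)}{\pi^3}x^2\right)^{\alpha_1x^3+\beta_1x^2+\gamma_1x+\delta_1}-\frac{\sin x}{x}.$$ Suppose that $$f_1(0+)=f_1'(0+)=f_1''(0+)=0,\qquad f_1\left(\tfrac{\pi}{2}\right)=f_1'\left(\tfrac{\pi}{2}\right)=f_1''\left(\tfrac{\pi}{2}\right)=0.$$ Then $$\alpha_1=\frac{(-\pi^3+24\pi-48)\ln^2\frac{\pi}{2}-3(\pi-2)(3\pi^2-20\pi+36)\ln\frac{\pi}{2}+24(\pi-3)(\pi-2)^2}{3(\pi-2)\pi^3\ln^2\frac{\pi}{2}},$$ $$\beta_1=\frac{(\pi^3-24\pi+48)\ln^2\frac{\pi}{2}+6(\pi-2)(\pi-4)^2\ln\frac{\pi}{2}-16(\pi-3)(\pi-2)^2}{2(\pi-2)\pi^2\ln^2\frac{\pi}{2}},$$ $$\gamma_1=\frac{(-\pi^3+24\pi-48)\ln^2\frac{\pi}{2}-(3\pi-10)(\pi-6)(\pi-2)\ln\frac{\pi}{2}+8(\pi-3)(\pi-2)^2}{4\pi(\pi-2)\ln^2\frac{\pi}{2}},$$ $$\delta_1=\frac{\pi^3}{24(\pi-2)},$$ and $f_1(x)>0$ for every $x\in\left(0,\frac{\pi}{2}\right)$.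
   Context: For a function $g$ defined to the right of $0$, $g(0+)=\lim_{x\to0^+}g(x)$; in particular $f'(0+)$ and $f''(0+)$ denote the right-hand limits at $0$ of the first and second derivatives. Derivatives at $x=\pi/2$ are the (left) derivatives there, equivalently the derivatives of the given formula, which is smooth in a neighbourhood of $\pi/2$. The base $1-\frac{4(\pi-2)}{\pi^3}x^2$ is positive on $\left(0,\frac{\pi}{2}\right]$, so the real power is well defined. $\ln^2 y$ means $(\ln y)^2$. *)

theory Defs
  imports "HOL-Analysis.Analysis"
begin

(* The formula is given on the whole real line. Only its values on (0, pi/2] matter; as it is
   smooth in a neighbourhood of pi/2, the two-sided derivatives there agree with the
   left derivatives. The base of powr is positive for |x| <= pi/2. *)
definition f1 :: "real \<Rightarrow> real \<Rightarrow> real \<Rightarrow> real \<Rightarrow> real \<Rightarrow> real" where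
  "f1 \<alpha> \<beta> \<gamma> \<delta> x =
     (1 - 4 * (pi - 2) / pi ^ 3 * x\<^sup>2) powr (\<alpha> * x ^ 3 + \<beta> * x\<^sup>2 + \<gamma> * x + \<delta>) - sin x / x"

end

theory Submission
  imports Defs "HOL-Real_Asymp.Real_Asymp"
begin

text \<open>
  Write \<open>c = 4 (\<pi> - 2) / \<pi>\<^sup>3 = s\<^sup>2\<close>, let \<open>p\<close> be the cubic exponent and consider the logarithmic gap
  \<open>G x = p x * ln (1 - c x\<^sup>2) - ln (sin x / x)\<close>, so that \<open>f1 x = (sin x / x) * (exp (G x) - 1)\<close>.
  Since \<open>sin x / x\<close> does not vanish, \<open>f1\<close> and \<open>G\<close> vanish to the same order at each endpoint and have
  the same sign in between. The six conditions thus say that \<open>G\<close> has a triple zero at \<open>0\<close> and at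
  \<open>\<pi> / 2\<close>. They are linear in the four coefficients: the condition on \<open>G''\<close> at \<open>0\<close> gives \<open>\<delta>\<close>, and
  the value and first two derivatives at \<open>\<pi> / 2\<close> give the other three
  (\<open>Hermite_conditions_solved\<close>, \<open>coefficients_closed_form\<close>).

  For the sign, the error formula of Hermite interpolation at these two triple nodes reads
  \<open>G x = (G ^ (6) \<xi> / 720) * x\<^sup>3 * (x - \<pi> / 2)\<^sup>3\<close>, whose polynomial factor is negative. It therefore suffices
  that the sixth derivative of \<open>G\<close> is negative on \<open>(0, \<pi> / 2)\<close> (\<open>Hermite_sextic_pos\<close>). That derivative
  is within reach for two reasons. As \<open>p\<close> is cubic, differentiating \<open>p x * ln (1 - c x\<^sup>2)\<close> six times
  leaves no logarithm, only an explicit rational function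
  (\<open>sixth_derivative_cubic_times_log\<close>). And by the reflection formula
  \<open>- ln (sin x / x) = ln_Gamma (1 + x / \<pi>) + ln_Gamma (1 - x / \<pi>)\<close>, which also
  makes \<open>G\<close> smooth at \<open>0\<close>, the remaining term is a sum of two values of
  \<open>Polygamma 5\<close>; in it only the pair of poles at \<open>\<plusminus>\<pi>\<close> matters, and the tail is
  bounded by a constant (\<open>Polygamma_5_sum_le\<close>).

  In the variable \<open>y = s x\<close> the logarithm becomes \<open>ln (1 - y\<^sup>2)\<close>, free of parameters. Each power of
  \<open>y\<close> times \<open>- ln (1 - y\<^sup>2)\<close> has nonnegative Taylor coefficients, so lower bounds for the four rescaled
  coefficients suffice, and the margin is so wide that one or two decimals are enough
  (\<open>coefficients_bounds\<close>). What is left is the comparison of two polynomials in \<open>y\<close> on an interval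
  (\<open>log_part_lower_bound\<close> and \<open>nearest_poles_bound\<close>), assembled in
  \<open>gap_sixth_derivative_neg\<close>.
\<close>

section \<open>Towers of derivatives\<close>

text \<open>
  A function bundled with candidates for all its derivatives. Statements about the first six
  derivatives then need no iterated \<open>deriv\<close>, and the calculus rules act on whole families.
\<close>

definition derivative_tower :: "(nat \<Rightarrow> real \<Rightarrow> real) \<Rightarrow> real set \<Rightarrow> bool" where
  "derivative_tower D S \<longleftrightarrow> (\<forall>k. \<forall>x\<in>S. (D k has_real_derivative D (Suc k) x) (at x))"

lemma derivative_towerD:
  "derivative_tower D S \<Longrightarrow> x \<in> S \<Longrightarrow> (D k has_real_derivative D (Suc k) x) (at x)"
  by (simp add: derivative_tower_def)

lemma derivative_tower_subset:
  "derivative_tower D S \<Longrightarrow> T \<subseteq> S \<Longrightarrow> derivative_tower D T"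
  by (auto simp: derivative_tower_def)

lemma derivative_tower_add:
  assumes "derivative_tower D S" "derivative_tower E S"
  shows "derivative_tower (\<lambda>k x. D k x + E k x) S"
  using assms by (auto simp: derivative_tower_def intro!: derivative_intros)

text \<open>
  The Leibniz formula. Pascal's rule merges the two sums that come from the product rule.
\<close>

lemma derivative_tower_mult:
  assumes D: "derivative_tower D S" and E: "derivative_tower E S"
  shows "derivative_tower (\<lambda>k x. \<Sum>j\<le>k. real (k choose j) * (D j x * E (k - j) x)) S"
  unfolding derivative_tower_def
proof (intro allI ballI)
  fix k x assume x: "x \<in> S"
  define a where "a j l = D j x * E l x" for j l
  have "((\<lambda>x. \<Sum>j\<le>k. real (k choose j) * (D j x * E (k - j) x)) has_real_derivative
      (\<Sum>j\<le>k. real (k choose j) * (a (Suc j) (k - j) + a j (Suc k - j)))) (at x)"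
  proof (rule DERIV_sum)
    fix j assume j: "j \<in> {..k}"
    show "((\<lambda>x. real (k choose j) * (D j x * E (k - j) x)) has_real_derivative
        real (k choose j) * (a (Suc j) (k - j) + a j (Suc k - j))) (at x)"
      using j unfolding a_def
      by (auto intro!: derivative_eq_intros derivative_towerD[OF D x] derivative_towerD[OF E x]
          simp: Suc_diff_le algebra_simps)
  qed
  also have "(\<Sum>j\<le>k. real (k choose j) * (a (Suc j) (k - j) + a j (Suc k - j)))
      = (\<Sum>j\<le>k. real (k choose j) * a (Suc j) (k - j)) + (\<Sum>j\<le>k. real (k choose j) * a j (Suc k - j))"
    by (simp add: sum.distrib algebra_simps)
  also have "(\<Sum>j\<le>k. real (k choose j) * a j (Suc k - j))
      = (\<Sum>j\<le>Suc k. real (k choose j) * a j (Suc k - j))"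
    by (simp add: binomial_eq_0)
  also have "\<dots> = a 0 (Suc k) + (\<Sum>j\<le>k. real (k choose Suc j) * a (Suc j) (k - j))"
    by (subst sum.atMost_Suc_shift) simp
  also have "(\<Sum>j\<le>k. real (k choose j) * a (Suc j) (k - j)) +
        (a 0 (Suc k) + (\<Sum>j\<le>k. real (k choose Suc j) * a (Suc j) (k - j)))
      = a 0 (Suc k) + (\<Sum>j\<le>k. real (Suc k choose Suc j) * a (Suc j) (k - j))"
    by (simp add: sum.distrib algebra_simps)
  also have "\<dots> = (\<Sum>j\<le>Suc k. real (Suc k choose j) * a j (Suc k - j))"
    by (subst sum.atMost_Suc_shift) simp
  finally show "((\<lambda>x. \<Sum>j\<le>k. real (k choose j) * (D j x * E (k - j) x)) has_real_derivative
      (\<Sum>j\<le>Suc k. real (Suc k choose j) * (D j x * E (Suc k - j) x))) (at x)"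
    by (simp add: a_def)
qed

lemma derivative_tower_affine:
  assumes "derivative_tower D S"
  shows "derivative_tower (\<lambda>k x. c ^ k * D k (a + c * x)) {x. a + c * x \<in> S}"
  unfolding derivative_tower_def
proof (intro allI ballI)
  fix k x assume "x \<in> {x. a + c * x \<in> S}"
  then have "(D k has_real_derivative D (Suc k) (a + c * x)) (at (a + c * x))"
    using assms by (auto intro: derivative_towerD)
  moreover have "((\<lambda>x. a + c * x) has_real_derivative c) (at x)"
    by (auto intro!: derivative_eq_intros)
  ultimately have "((\<lambda>x. D k (a + c * x)) has_real_derivative D (Suc k) (a + c * x) * c) (at x)"
    by (rule DERIV_chain2)
  from DERIV_cmult[OF this, of "c ^ k"]
  show "((\<lambda>x. c ^ k * D k (a + c * x)) has_real_derivative c ^ Suc k * D (Suc k) (a + c * x)) (at x)"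
    by (simp add: mult_ac)
qed

definition cubic_tower :: "real \<Rightarrow> real \<Rightarrow> real \<Rightarrow> real \<Rightarrow> nat \<Rightarrow> real \<Rightarrow> real" where
  "cubic_tower a b c d k x =
     (if k = 0 then a * x ^ 3 + b * x\<^sup>2 + c * x + d
      else if k = 1 then 3 * a * x\<^sup>2 + 2 * b * x + c
      else if k = 2 then 6 * a * x + 2 * b
      else if k = 3 then 6 * a else 0)"

lemma derivative_tower_cubic: "derivative_tower (cubic_tower a b c d) S"
  unfolding derivative_tower_def
proof (intro allI ballI)
  fix k :: nat and x
  consider "k = 0" | "k = 1" | "k = 2" | "k \<ge> 3" by linarith
  then show "(cubic_tower a b c d k has_real_derivative cubic_tower a b c d (Suc k) x) (at x)"
    by cases (auto simp: cubic_tower_def[abs_def] intro!: derivative_eq_intros)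
qed

section \<open>Positivity from a negative sixth derivative\<close>

lemma derivative_tower_Rolle:
  assumes "derivative_tower D {a..b}" "a \<le> r" "s \<le> b" "r < s" "D k r = 0" "D k s = 0"
    and m: "m = Suc k"
  shows "\<exists>t>r. t < s \<and> D m t = 0"
proof -
  have d: "(D k has_real_derivative D (Suc k) x) (at x)" if "x \<in> {r..s}" for x
    using assms that by (intro derivative_towerD[OF assms(1)]) auto
  have "\<exists>t>r. t < s \<and> D k s - D k r = (s - r) * D (Suc k) t"
    using d assms by (intro MVT2) auto
  then show ?thesis using assms by auto
qed

text \<open>
  The sign part of the error formula for Hermite interpolation at two triple nodes. If the
  function were not positive at \<open>x\<close>, one could add a nonnegative multiple \<open>K\<close> of
  \<open>(t - a)\<^sup>3 (b - t)\<^sup>3\<close> that produces a further zero at \<open>x\<close>. The sum then has seven zeros counted with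
  multiplicity, so its sixth derivative has a zero; but the sixth derivative of the added polynomial is
  \<open>- 720 K\<close>, which keeps it negative.
\<close>

lemma Hermite_sextic_pos:
  assumes D: "derivative_tower D {a..b}"
    and zero: "\<And>k. k < 3 \<Longrightarrow> D k a = 0" "\<And>k. k < 3 \<Longrightarrow> D k b = 0"
    and neg: "\<And>x. a < x \<Longrightarrow> x < b \<Longrightarrow> D 6 x < 0"
    and x: "a < x" "x < b"
  shows "D 0 x > 0"
proof (rule ccontr)
  assume "\<not> D 0 x > 0"
  define K where "K = - D 0 x / ((x - a) ^ 3 * (b - x) ^ 3)"
  have K: "K \<ge> 0" and Kx: "K * ((x - a) ^ 3 * (b - x) ^ 3) = - D 0 x"
    using \<open>\<not> D 0 x > 0\<close> x by (auto simp: K_def divide_simps)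
  \<comment> \<open>The Leibniz tower of \<open>(t - a)\<^sup>3 * (b - t)\<^sup>3\<close>, each factor a shifted cube.\<close>
  define U V where "U k t = 1 ^ k * cubic_tower 1 0 0 0 k (- a + 1 * t)"
    and "V k t = (- 1) ^ k * cubic_tower 1 0 0 0 k (b + - 1 * t)" for k and t :: real
  define Q where "Q k t = (\<Sum>j\<le>k. real (k choose j) * (U j t * V (k - j) t))" for k t
  have "derivative_tower U {a..b}" "derivative_tower V {a..b}"
    unfolding U_def V_def
    by (rule derivative_tower_subset[OF derivative_tower_affine[OF derivative_tower_cubic[of _ _ _ _ UNIV]]], simp)+
  then have Q: "derivative_tower Q {a..b}"
    unfolding Q_def by (rule derivative_tower_mult)
  have Q0: "Q 0 t = (t - a) ^ 3 * (b - t) ^ 3" for t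
    by (simp add: Q_def U_def V_def cubic_tower_def)
  have Qab: "Q k a = 0" "Q k b = 0" if "k < 3" for k
    using that by (auto simp: Q_def U_def V_def cubic_tower_def intro!: sum.neutral)
  have Q6: "Q 6 t = - 720" for t
  proof -
    have "Q 6 t = (\<Sum>j\<in>{3}. real (6 choose j) * (U j t * V (6 - j) t))"
      unfolding Q_def by (rule sum.mono_neutral_right) (auto simp: U_def V_def cubic_tower_def)
    moreover have "(6 choose 3 :: nat) = 20" by (simp add: eval_nat_numeral)
    ultimately show ?thesis by (simp add: U_def V_def cubic_tower_def)
  qed
  have "derivative_tower (\<lambda>k t. K * Q k t) {a..b}"
    using Q by (auto simp: derivative_tower_def intro!: DERIV_cmult)
  from derivative_tower_add[OF D this]
  have H: "derivative_tower (\<lambda>k t. D k t + K * Q k t) {a..b}" .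
  define E where "E k t = D k t + K * Q k t" for k t
  have R: "\<exists>t>r. t < s \<and> E m t = 0"
    if "a \<le> r" "s \<le> b" "r < s" "E k r = 0" "E k s = 0" "m = Suc k" for r s k m
    using derivative_tower_Rolle[OF H, of r s k m] that unfolding E_def by blast
  have Ea: "E k a = 0" "E k b = 0" if "k < 3" for k
    using that zero Qab by (simp_all add: E_def)
  \<comment> \<open>Rolle: \<open>3\<close> zeros of \<open>E 0\<close>, and \<open>4, 5, 4, 3, 2, 1\<close> zeros of \<open>E 1\<close> to \<open>E 6\<close>, where the endpoints
    count as zeros of \<open>E 1\<close> and \<open>E 2\<close> too.\<close>
  have "E 0 x = 0" using Kx by (simp add: E_def Q0)
  have "\<exists>t>a. t < x \<and> E 1 t = 0"
    using x by (intro R[OF _ _ _ Ea(1) \<open>E 0 x = 0\<close>]) simp_all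
  then obtain p1 where p1: "a < p1" "p1 < x" "E 1 p1 = 0" by blast
  have "\<exists>t>x. t < b \<and> E 1 t = 0"
    using x p1(1,2) by (intro R[OF _ _ _ \<open>E 0 x = 0\<close> Ea(2)]) simp_all
  then obtain p2 where p2: "x < p2" "p2 < b" "E 1 p2 = 0" by blast
  have "\<exists>t>a. t < p1 \<and> E 2 t = 0"
    using x p1(1,2) p2(1,2) by (intro R[OF _ _ _ Ea(1) p1(3)]) simp_all
  then obtain q1 where q1: "a < q1" "q1 < p1" "E 2 q1 = 0" by blast
  have "\<exists>t>p1. t < p2 \<and> E 2 t = 0"
    using x p1(1,2) p2(1,2) q1(1,2) by (intro R[OF _ _ _ p1(3) p2(3)]) simp_all
  then obtain q2 where q2: "p1 < q2" "q2 < p2" "E 2 q2 = 0" by blast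
  have "\<exists>t>p2. t < b \<and> E 2 t = 0"
    using x p1(1,2) p2(1,2) q1(1,2) q2(1,2) by (intro R[OF _ _ _ p2(3) Ea(2)]) simp_all
  then obtain q3 where q3: "p2 < q3" "q3 < b" "E 2 q3 = 0" by blast
  have "\<exists>t>a. t < q1 \<and> E 3 t = 0"
    using x p1(1,2) p2(1,2) q1(1,2) q2(1,2) q3(1,2) by (intro R[OF _ _ _ Ea(1) q1(3)]) simp_all
  then obtain r1 where r1: "a < r1" "r1 < q1" "E 3 r1 = 0" by blast
  have "\<exists>t>q1. t < q2 \<and> E 3 t = 0"
    using x p1(1,2) p2(1,2) q1(1,2) q2(1,2) q3(1,2) r1(1,2) by (intro R[OF _ _ _ q1(3) q2(3)]) simp_all
  then obtain r2 where r2: "q1 < r2" "r2 < q2" "E 3 r2 = 0" by blast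
  have "\<exists>t>q2. t < q3 \<and> E 3 t = 0"
    using x p1(1,2) p2(1,2) q1(1,2) q2(1,2) q3(1,2) r1(1,2) r2(1,2) by (intro R[OF _ _ _ q2(3) q3(3)]) simp_all
  then obtain r3 where r3: "q2 < r3" "r3 < q3" "E 3 r3 = 0" by blast
  have "\<exists>t>q3. t < b \<and> E 3 t = 0"
    using x p1(1,2) p2(1,2) q1(1,2) q2(1,2) q3(1,2) r1(1,2) r2(1,2) r3(1,2) by (intro R[OF _ _ _ q3(3) Ea(2)]) simp_all
  then obtain r4 where r4: "q3 < r4" "r4 < b" "E 3 r4 = 0" by blast
  have "\<exists>t>r1. t < r2 \<and> E 4 t = 0"
    using x p1(1,2) p2(1,2) q1(1,2) q2(1,2) q3(1,2) r1(1,2) r2(1,2) r3(1,2) r4(1,2) by (intro R[OF _ _ _ r1(3) r2(3)]) simp_all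
  then obtain s1 where s1: "r1 < s1" "s1 < r2" "E 4 s1 = 0" by blast
  have "\<exists>t>r2. t < r3 \<and> E 4 t = 0"
    using x p1(1,2) p2(1,2) q1(1,2) q2(1,2) q3(1,2) r1(1,2) r2(1,2) r3(1,2) r4(1,2) s1(1,2) by (intro R[OF _ _ _ r2(3) r3(3)]) simp_all
  then obtain s2 where s2: "r2 < s2" "s2 < r3" "E 4 s2 = 0" by blast
  have "\<exists>t>r3. t < r4 \<and> E 4 t = 0"
    using x p1(1,2) p2(1,2) q1(1,2) q2(1,2) q3(1,2) r1(1,2) r2(1,2) r3(1,2) r4(1,2) s1(1,2) s2(1,2) by (intro R[OF _ _ _ r3(3) r4(3)]) simp_all
  then obtain s3 where s3: "r3 < s3" "s3 < r4" "E 4 s3 = 0" by blast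
  have "\<exists>t>s1. t < s2 \<and> E 5 t = 0"
    using x p1(1,2) p2(1,2) q1(1,2) q2(1,2) q3(1,2) r1(1,2) r2(1,2) r3(1,2) r4(1,2) s1(1,2) s2(1,2) s3(1,2) by (intro R[OF _ _ _ s1(3) s2(3)]) simp_all
  then obtain t1 where t1: "s1 < t1" "t1 < s2" "E 5 t1 = 0" by blast
  have "\<exists>t>s2. t < s3 \<and> E 5 t = 0"
    using x p1(1,2) p2(1,2) q1(1,2) q2(1,2) q3(1,2) r1(1,2) r2(1,2) r3(1,2) r4(1,2) s1(1,2) s2(1,2) s3(1,2) t1(1,2) by (intro R[OF _ _ _ s2(3) s3(3)]) simp_all
  then obtain t2 where t2: "s2 < t2" "t2 < s3" "E 5 t2 = 0" by blast
  have "\<exists>t>t1. t < t2 \<and> E 6 t = 0"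
    using x p1(1,2) p2(1,2) q1(1,2) q2(1,2) q3(1,2) r1(1,2) r2(1,2) r3(1,2) r4(1,2) s1(1,2) s2(1,2) s3(1,2) t1(1,2) t2(1,2) by (intro R[OF _ _ _ t1(3) t2(3)]) simp_all
  then obtain w where w: "t1 < w" "w < t2" "E 6 w = 0" by blast
  have "D 6 w < 0" using neg[of w] x p1(1,2) p2(1,2) q1(1,2) q2(1,2) q3(1,2) r1(1,2) r2(1,2) r3(1,2) r4(1,2) s1(1,2) s2(1,2) s3(1,2) t1(1,2) t2(1,2) w(1,2) by simp
  moreover have "E 6 w = D 6 w - 720 * K" by (simp add: E_def Q6)
  ultimately show False using w K by simp
qed

section \<open>The gap function\<close>

text \<open>
  The derivatives of \<open>D (1 + c x) + D (1 - c x)\<close>. Both halves of the gap have this form: with the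
  logarithm and \<open>c = s\<close> it is \<open>ln (1 - s\<^sup>2 x\<^sup>2)\<close>, with log-Gamma and \<open>c = 1 / \<pi>\<close> it is
  \<open>- ln (sin x / x)\<close>.
\<close>

definition reflected_sum :: "(nat \<Rightarrow> real \<Rightarrow> real) \<Rightarrow> real \<Rightarrow> nat \<Rightarrow> real \<Rightarrow> real" where
  "reflected_sum D c k x = c ^ k * D k (1 + c * x) + (- c) ^ k * D k (1 + - c * x)"

lemma derivative_tower_reflected_sum:
  assumes "derivative_tower D {0<..}"
  shows "derivative_tower (reflected_sum D c) {x. \<bar>c * x\<bar> < 1}"
proof -
  have "derivative_tower (\<lambda>k x. c ^ k * D k (1 + c * x) + (- c) ^ k * D k (1 + - c * x)) {x. \<bar>c * x\<bar> < 1}"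
    by (intro derivative_tower_add; rule derivative_tower_subset[OF derivative_tower_affine[OF assms]]) auto
  then show ?thesis by (simp add: reflected_sum_def[abs_def])
qed

definition ln_tower :: "nat \<Rightarrow> real \<Rightarrow> real" where
  "ln_tower k = (case k of 0 \<Rightarrow> ln | Suc n \<Rightarrow> (\<lambda>x. (- 1) ^ n * fact n * inverse x ^ k))"

lemma derivative_tower_ln: "derivative_tower ln_tower {0<..}"
  unfolding derivative_tower_def
proof (intro allI ballI)
  fix k and x :: real assume x: "x \<in> {0<..}"
  show "(ln_tower k has_real_derivative ln_tower (Suc k) x) (at x)"
  proof (cases k)
    case 0
    then show ?thesis using x by (auto simp: ln_tower_def inverse_eq_divide intro!: DERIV_ln_divide)
  next
    case (Suc n)
    have "((\<lambda>x. inverse x) has_real_derivative - (inverse x ^ Suc (Suc 0))) (at x)"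
      using x by (intro DERIV_inverse) simp
    from DERIV_cmult[OF DERIV_power[OF this, of "Suc n"], of "(- 1) ^ n * fact n"]
    show ?thesis
      unfolding Suc ln_tower_def nat.case by (rule DERIV_cong) (simp add: algebra_simps)
  qed
qed

definition lgamma_tower :: "nat \<Rightarrow> real \<Rightarrow> real" where
  "lgamma_tower k = (case k of 0 \<Rightarrow> ln_Gamma | Suc n \<Rightarrow> Polygamma n)"

lemma derivative_tower_lgamma: "derivative_tower lgamma_tower {0<..}"
  unfolding derivative_tower_def
proof (intro allI ballI)
  fix k and x :: real assume x: "x \<in> {0<..}"
  then have "x \<notin> \<int>\<^sub>\<le>\<^sub>0" by (auto elim!: nonpos_Ints_cases)
  with x show "(lgamma_tower k has_real_derivative lgamma_tower (Suc k) x) (at x)"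
    by (cases k) (auto simp: lgamma_tower_def intro!: has_field_derivative_Polygamma has_field_derivative_ln_Gamma_real)
qed

text \<open>
  Euler's reflection formula \<open>\<Gamma> z * \<Gamma> (1 - z) = \<pi> / sin (\<pi> z)\<close>, with \<open>\<Gamma> (1 + z) = z * \<Gamma> z\<close> removing
  the pole at \<open>z = 0\<close>.
\<close>

lemma neg_log_sinc:
  assumes "0 < x" "x < pi"
  shows "reflected_sum lgamma_tower (1 / pi) 0 x = - ln (sin x / x)"
proof -
  define z where "z = x / pi"
  have z: "0 < z" "z < 1" using assms by (auto simp: z_def)
  have "complex_of_real (rGamma z * rGamma (1 - z)) = complex_of_real (sin (pi * z) / pi)"
    using rGamma_reflection_complex[of "complex_of_real z"]
    by (simp add: rGamma_complex_of_real[symmetric] sin_of_real[symmetric])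
  then have "rGamma z * rGamma (1 - z) = sin x / pi"
    unfolding of_real_eq_iff using assms by (simp add: z_def)
  then have r: "Gamma z * Gamma (1 - z) = pi / sin x"
    by (metis Gamma_def inverse_divide inverse_mult_distrib)
  have "z \<notin> \<int>\<^sub>\<le>\<^sub>0" using z by (auto elim!: nonpos_Ints_cases)
  have "Gamma (1 + z) = z * Gamma z"
    using Gamma_plus1[of z] \<open>z \<notin> \<int>\<^sub>\<le>\<^sub>0\<close> by (simp add: add.commute)
  have "reflected_sum lgamma_tower (1 / pi) 0 x = ln_Gamma (1 + z) + ln_Gamma (1 - z)"
    by (simp add: reflected_sum_def lgamma_tower_def z_def)
  also have "\<dots> = ln (z * Gamma z * Gamma (1 - z))"
    using z Gamma_real_pos[of z] Gamma_real_pos[of "1 - z"]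
    by (simp add: ln_Gamma_real_pos \<open>Gamma (1 + z) = z * Gamma z\<close> ln_mult less_imp_neq[symmetric])
  also have "z * Gamma z * Gamma (1 - z) = inverse (sin x / x)"
    unfolding mult.assoc r by (simp add: z_def)
  also have "ln \<dots> = - ln (sin x / x)"
    using assms sin_gt_zero[of x] by (simp add: ln_div)
  finally show ?thesis .
qed

text \<open>
  These closed forms give the values at \<open>\<pi> / 2\<close>, where the polygamma functions themselves are less
  convenient. They follow by uniqueness of derivatives from the formula for the function.
\<close>

lemma neg_log_sinc_derivatives:
  assumes x: "0 < x" "x < pi"
  shows "reflected_sum lgamma_tower (1 / pi) 1 x = 1 / x - cos x / sin x"
    and "reflected_sum lgamma_tower (1 / pi) 2 x = 1 / (sin x)\<^sup>2 - 1 / x\<^sup>2"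
proof -
  let ?R = "reflected_sum lgamma_tower (1 / pi)"
  have R: "(?R k has_real_derivative ?R (Suc k) t) (at t)" if "t \<in> {0<..<pi}" for k t
    by (rule derivative_towerD[OF derivative_tower_reflected_sum[OF derivative_tower_lgamma]])
       (use that in \<open>auto simp: abs_mult\<close>)
  have 1: "?R 1 t = 1 / t - cos t / sin t" if t: "t \<in> {0<..<pi}" for t
  proof -
    have "sin t > 0" using t by (auto intro: sin_gt_zero)
    then have "((\<lambda>t. - ln (sin t / t)) has_real_derivative 1 / t - cos t / sin t) (at t)"
      using t by (auto intro!: derivative_eq_intros simp: field_simps)
    then have "(?R 0 has_real_derivative 1 / t - cos t / sin t) (at t)"
      by (rule DERIV_cong_ev[THEN iffD1, rotated -1])
         (use t neg_log_sinc in \<open>auto intro!: eventually_mono[OF eventually_nhds_in_open[of "{0<..<pi}"]]\<close>)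
    from DERIV_unique[OF this R[OF t, of 0]] show ?thesis by simp
  qed
  then show "?R 1 x = 1 / x - cos x / sin x" using x by simp
  have "sin x > 0" using x by (auto intro: sin_gt_zero)
  have "((\<lambda>t. 1 / t - cos t / sin t) has_real_derivative 1 / (sin x)\<^sup>2 - 1 / x\<^sup>2) (at x)"
  proof (rule DERIV_cong)
    show "((\<lambda>t. 1 / t - cos t / sin t) has_real_derivative
        (0 * x - 1 * 1) / (x * x) - (- sin x * sin x - cos x * cos x) / (sin x * sin x)) (at x)"
      using x \<open>sin x > 0\<close>
      by (intro DERIV_diff DERIV_divide DERIV_cos DERIV_sin DERIV_const DERIV_ident) auto
    have "- sin x * sin x - cos x * cos x = - 1"
      using sin_cos_squared_add[of x] by (simp add: power2_eq_square)
    then show "(0 * x - 1 * 1) / (x * x) - (- sin x * sin x - cos x * cos x) / (sin x * sin x)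
        = 1 / (sin x)\<^sup>2 - 1 / x\<^sup>2"
      by (simp add: power2_eq_square)
  qed
  then have "(?R 1 has_real_derivative 1 / (sin x)\<^sup>2 - 1 / x\<^sup>2) (at x)"
    by (rule DERIV_cong_ev[THEN iffD1, rotated -1])
       (use x 1 in \<open>auto intro!: eventually_mono[OF eventually_nhds_in_open[of "{0<..<pi}"]]\<close>)
  from DERIV_unique[OF this R[of x 1]] x show "?R 2 x = 1 / (sin x)\<^sup>2 - 1 / x\<^sup>2"
    by (simp add: numeral_2_eq_2)
qed

text \<open>
  The gap \<open>G\<close> for the exponent \<open>a x\<^sup>3 + b x\<^sup>2 + c x + d\<close> and \<open>s\<close> with \<open>s\<^sup>2 = 4 (\<pi> - 2) / \<pi>\<^sup>3\<close>: the
  Leibniz sums for exponent times logarithm, plus the derivatives of \<open>- ln (sin x / x)\<close> in a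
  form that is smooth at \<open>0\<close>.
\<close>

definition gap_tower :: "real \<Rightarrow> real \<Rightarrow> real \<Rightarrow> real \<Rightarrow> real \<Rightarrow> nat \<Rightarrow> real \<Rightarrow> real" where
  "gap_tower a b c d s k x =
     (\<Sum>j\<le>k. real (k choose j) * (cubic_tower a b c d j x * reflected_sum ln_tower s (k - j) x))
     + reflected_sum lgamma_tower (1 / pi) k x"

lemma derivative_tower_gap:
  "derivative_tower (gap_tower a b c d s) {x. \<bar>s * x\<bar> < 1 \<and> \<bar>x\<bar> < pi}"
  unfolding gap_tower_def
proof (intro derivative_tower_add derivative_tower_mult derivative_tower_cubic)
  show "derivative_tower (reflected_sum ln_tower s) {x. \<bar>s * x\<bar> < 1 \<and> \<bar>x\<bar> < pi}"
    by (rule derivative_tower_subset[OF derivative_tower_reflected_sum[OF derivative_tower_ln]]) auto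
  show "derivative_tower (reflected_sum lgamma_tower (1 / pi)) {x. \<bar>s * x\<bar> < 1 \<and> \<bar>x\<bar> < pi}"
    by (rule derivative_tower_subset[OF derivative_tower_reflected_sum[OF derivative_tower_lgamma]])
       (auto simp: abs_mult)
qed

lemma f1_eq_sinc_mult_exp_gap:
  assumes s: "s > 0" "s\<^sup>2 = 4 * (pi - 2) / pi ^ 3" and x: "0 < x" "x < pi" "s * x < 1"
  shows "f1 a b c d x = sin x / x * (exp (gap_tower a b c d s 0 x) - 1)"
proof -
  define q where "q = cubic_tower a b c d 0 x"
  have "sin x / x > 0" using x by (simp add: sin_gt_zero)
  have pos: "s * x > 0" using s x by simp
  have "1 - 4 * (pi - 2) / pi ^ 3 * x\<^sup>2 = (1 + s * x) * (1 - s * x)"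
    unfolding s(2)[symmetric] by algebra
  moreover have "(1 + s * x) * (1 - s * x) > 0" using pos x by simp
  ultimately have powr: "(1 - 4 * (pi - 2) / pi ^ 3 * x\<^sup>2) powr q
      = exp (q * (ln (1 + s * x) + ln (1 - s * x)))"
    using pos x by (simp add: powr_def ln_mult)
  have "gap_tower a b c d s 0 x = q * (ln (1 + s * x) + ln (1 - s * x)) - ln (sin x / x)"
    using neg_log_sinc[of x] x by (simp add: gap_tower_def q_def reflected_sum_def[of ln_tower] ln_tower_def)
  then have "exp (gap_tower a b c d s 0 x) = exp (q * (ln (1 + s * x) + ln (1 - s * x))) / (sin x / x)"
    using \<open>sin x / x > 0\<close> by (simp only: exp_diff exp_ln)
  have "sin x / x * exp (gap_tower a b c d s 0 x) = exp (q * (ln (1 + s * x) + ln (1 - s * x)))"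
  proof -
    have "B * (e / B) = e" if "B > 0" for B e :: real using that by simp
    from this[OF \<open>sin x / x > 0\<close>] show ?thesis by (simp only: \<open>exp (gap_tower a b c d s 0 x) = _\<close>)
  qed
  moreover have "q = a * x ^ 3 + b * x\<^sup>2 + c * x + d" by (simp add: q_def cubic_tower_def)
  ultimately show ?thesis
    using powr by (simp only: f1_def right_diff_distrib mult_1_right)
qed

text \<open>
  Where \<open>B\<close> does not vanish, these formulas let the vanishing of \<open>f\<close>, \<open>f'\<close> and \<open>f''\<close> be read off, one
  order after the other, as the vanishing of the first three entries of \<open>D\<close>.
\<close>

lemma derivatives_mult_exp_minus_1:
  assumes U: "open U" and D: "derivative_tower D U"
    and B: "\<And>x. x \<in> U \<Longrightarrow> (B has_real_derivative B1 x) (at x)"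
      "\<And>x. x \<in> U \<Longrightarrow> (B1 has_real_derivative B2 x) (at x)"
    and f: "\<And>x. x \<in> U \<Longrightarrow> f x = B x * (exp (D 0 x) - 1)"
    and x: "x \<in> U"
  shows "deriv f x = B1 x * (exp (D 0 x) - 1) + B x * (exp (D 0 x) * D 1 x)"
    and "deriv (deriv f) x = B2 x * (exp (D 0 x) - 1) + 2 * (B1 x * (exp (D 0 x) * D 1 x))
        + B x * (exp (D 0 x) * ((D 1 x)\<^sup>2 + D 2 x))"
proof -
  have D0: "(D 0 has_real_derivative D 1 t) (at t)" if "t \<in> U" for t
    using derivative_towerD[OF D that, of 0] by simp
  have D1: "(D 1 has_real_derivative D 2 t) (at t)" if "t \<in> U" for t
    using derivative_towerD[OF D that, of 1] by (simp add: numeral_2_eq_2)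
  have e: "((\<lambda>t. exp (D 0 t)) has_real_derivative exp (D 0 t) * D 1 t) (at t)" if "t \<in> U" for t
    by (rule DERIV_fun_exp[OF D0[OF that]])
  have e1: "((\<lambda>t. exp (D 0 t) - 1) has_real_derivative exp (D 0 t) * D 1 t) (at t)" if "t \<in> U" for t
    using DERIV_diff[OF e[OF that] DERIV_const[of 1]] by simp
  have "((\<lambda>t. B t * (exp (D 0 t) - 1)) has_real_derivative
      B1 t * (exp (D 0 t) - 1) + B t * (exp (D 0 t) * D 1 t)) (at t)" if "t \<in> U" for t
  proof -
    from DERIV_mult[OF B(1)[OF that] e1[OF that]] show ?thesis by (rule DERIV_cong) (simp add: mult.commute)
  qed
  then have "(f has_real_derivative B1 t * (exp (D 0 t) - 1) + B t * (exp (D 0 t) * D 1 t)) (at t)"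
    if "t \<in> U" for t
    by (rule has_field_derivative_transform_within_open[OF _ U that f[symmetric]]) (fact that)+
  then have f': "deriv f t = B1 t * (exp (D 0 t) - 1) + B t * (exp (D 0 t) * D 1 t)" if "t \<in> U" for t
    by (rule DERIV_imp_deriv) (fact that)
  then show "deriv f x = B1 x * (exp (D 0 x) - 1) + B x * (exp (D 0 x) * D 1 x)" using x by simp
  have "((\<lambda>t. B1 t * (exp (D 0 t) - 1) + B t * (exp (D 0 t) * D 1 t)) has_real_derivative
      B2 x * (exp (D 0 x) - 1) + exp (D 0 x) * D 1 x * B1 x
      + (B1 x * (exp (D 0 x) * D 1 x) + (exp (D 0 x) * D 1 x * D 1 x + D 2 x * exp (D 0 x)) * B x)) (at x)"
    by (rule DERIV_add[OF DERIV_mult[OF B(2)[OF x] e1[OF x]]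
          DERIV_mult[OF B(1)[OF x] DERIV_mult[OF e[OF x] D1[OF x]]]])
  moreover have "B2 x * (exp (D 0 x) - 1) + exp (D 0 x) * D 1 x * B1 x
      + (B1 x * (exp (D 0 x) * D 1 x) + (exp (D 0 x) * D 1 x * D 1 x + D 2 x * exp (D 0 x)) * B x)
    = B2 x * (exp (D 0 x) - 1) + 2 * (B1 x * (exp (D 0 x) * D 1 x))
        + B x * (exp (D 0 x) * ((D 1 x)\<^sup>2 + D 2 x))"
    by (simp add: algebra_simps power2_eq_square)
  ultimately have "((\<lambda>t. B1 t * (exp (D 0 t) - 1) + B t * (exp (D 0 t) * D 1 t)) has_real_derivative
      B2 x * (exp (D 0 x) - 1) + 2 * (B1 x * (exp (D 0 x) * D 1 x))
        + B x * (exp (D 0 x) * ((D 1 x)\<^sup>2 + D 2 x))) (at x)" by (simp only:)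
  then have "(deriv f has_real_derivative B2 x * (exp (D 0 x) - 1) + 2 * (B1 x * (exp (D 0 x) * D 1 x))
        + B x * (exp (D 0 x) * ((D 1 x)\<^sup>2 + D 2 x))) (at x)"
    by (rule has_field_derivative_transform_within_open[OF _ U x f'[symmetric]])
  then show "deriv (deriv f) x = B2 x * (exp (D 0 x) - 1) + 2 * (B1 x * (exp (D 0 x) * D 1 x))
        + B x * (exp (D 0 x) * ((D 1 x)\<^sup>2 + D 2 x))"
    by (rule DERIV_imp_deriv)
qed

section \<open>The sixth derivative of the gap\<close>

text \<open>
  The polynomial in \<open>y\<close> multiplying each coefficient is \<open>(1 - y\<^sup>2) ^ 6\<close> times the sixth derivative of
  \<open>- y ^ j * ln (1 - y\<^sup>2)\<close> for \<open>j = 0, 1, 2, 3\<close>. Only \<open>j \<le> 3\<close> contributes to the Leibniz sum, hence only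
  derivatives of the logarithm of order at least three, all of them rational.
\<close>

lemma sixth_derivative_cubic_times_log:
  fixes s x :: real
  defines "y \<equiv> s * x"
  assumes y: "\<bar>y\<bar> < 1"
  shows "(1 - y\<^sup>2) ^ 6 * (\<Sum>j\<le>6. real (6 choose j) *
        (cubic_tower a b c d j x * reflected_sum ln_tower s (6 - j) x)) =
      - (s ^ 6 * d * (240 + 3600 * y\<^sup>2 + 3600 * y ^ 4 + 240 * y ^ 6)
       + s ^ 5 * c * (1680 * y + 5040 * y ^ 3 + 1008 * y ^ 5 - 48 * y ^ 7)
       + s ^ 4 * b * (360 + 4560 * y\<^sup>2 + 2880 * y ^ 4 - 144 * y ^ 6 + 24 * y ^ 8)
       + s ^ 3 * a * (2520 * y + 5040 * y ^ 3 + 144 * y ^ 7 - 24 * y ^ 9))"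
proof -
  define L where "L k = reflected_sum ln_tower s k x" for k
  define P N where "P = 1 + y" and "N = 1 - y"
  have PN: "P \<noteq> 0" "N \<noteq> 0" using y by (auto simp: P_def N_def)
  have w: "(1 - y\<^sup>2) ^ 6 = P ^ 6 * N ^ 6"
    by (simp add: P_def N_def power2_eq_square algebra_simps flip: power_mult_distrib)
  have c: "(6 choose 2 :: nat) = 15" "(6 choose 3 :: nat) = 20"
    by (simp_all add: eval_nat_numeral)
  have "(\<Sum>j\<le>6. real (6 choose j) * (cubic_tower a b c d j x * reflected_sum ln_tower s (6 - j) x))
      = (\<Sum>j\<in>{0, 1, 2, 3}. real (6 choose j) * (cubic_tower a b c d j x * L (6 - j)))"
    unfolding L_def by (rule sum.mono_neutral_right) (auto simp: cubic_tower_def)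
  also have "\<dots> = (a * x ^ 3 + b * x\<^sup>2 + c * x + d) * L 6 + 6 * (3 * a * x\<^sup>2 + 2 * b * x + c) * L 5
      + 15 * (6 * a * x + 2 * b) * L 4 + 20 * (6 * a) * L 3"
    using c by (simp add: cubic_tower_def algebra_simps)
  finally have sum: "(\<Sum>j\<le>6. real (6 choose j) * (cubic_tower a b c d j x * reflected_sum ln_tower s (6 - j) x))
      = \<dots>" .
  have L: "L (Suc n) = (- 1) ^ n * fact n * s ^ Suc n * (inverse P ^ Suc n + (- 1) ^ Suc n * inverse N ^ Suc n)" for n
  proof -
    have "1 + - s * x = N" by (simp add: N_def y_def)
    then show ?thesis
      unfolding L_def reflected_sum_def ln_tower_def nat.case power_minus[of s] P_def[unfolded y_def, symmetric]
      by (simp only: algebra_simps)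
  qed
  have i: "P ^ 6 * N ^ 6 * inverse P ^ k = P ^ (6 - k) * N ^ 6"
    "P ^ 6 * N ^ 6 * inverse N ^ k = P ^ 6 * N ^ (6 - k)" if "k \<le> 6" for k
    using that PN by (simp_all add: power_diff power_inverse divide_inverse)
  have iL: "P ^ 6 * N ^ 6 * L (Suc n) = (- 1) ^ n * fact n * s ^ Suc n *
      (P ^ (6 - Suc n) * N ^ 6 + (- 1) ^ Suc n * (P ^ 6 * N ^ (6 - Suc n)))" if "n \<le> 5" for n
  proof -
    have "P ^ 6 * N ^ 6 * L (Suc n) = (- 1) ^ n * fact n * s ^ Suc n *
      ((P ^ 6 * N ^ 6 * inverse P ^ Suc n) + (- 1) ^ Suc n * (P ^ 6 * N ^ 6 * inverse N ^ Suc n))"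
      unfolding L by (simp only: algebra_simps)
    then show ?thesis using that by (simp only: i)
  qed
  have L6: "P ^ 6 * N ^ 6 * L 6 = - 120 * s ^ 6 * (N ^ 6 + P ^ 6)"
    using iL[of 5] by (simp add: fact_numeral)
  have L5: "P ^ 6 * N ^ 6 * L 5 = 24 * s ^ 5 * (P * N ^ 6 - P ^ 6 * N)"
    using iL[of 4] by (simp add: fact_numeral)
  have L4: "P ^ 6 * N ^ 6 * L 4 = - 6 * s ^ 4 * (P\<^sup>2 * N ^ 6 + P ^ 6 * N\<^sup>2)"
    using iL[of 3] by (simp add: fact_numeral)
  have L3: "P ^ 6 * N ^ 6 * L 3 = 2 * s ^ 3 * (P ^ 3 * N ^ 6 - P ^ 6 * N ^ 3)"
    using iL[of 2] by (simp add: fact_numeral)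
  have "P ^ 6 * N ^ 6 * ((a * x ^ 3 + b * x\<^sup>2 + c * x + d) * L 6 + 6 * (3 * a * x\<^sup>2 + 2 * b * x + c) * L 5
      + 15 * (6 * a * x + 2 * b) * L 4 + 20 * (6 * a) * L 3)
    = (a * x ^ 3 + b * x\<^sup>2 + c * x + d) * (P ^ 6 * N ^ 6 * L 6)
      + 6 * (3 * a * x\<^sup>2 + 2 * b * x + c) * (P ^ 6 * N ^ 6 * L 5)
      + 15 * (6 * a * x + 2 * b) * (P ^ 6 * N ^ 6 * L 4) + 20 * (6 * a) * (P ^ 6 * N ^ 6 * L 3)"
    by (simp only: distrib_left distrib_right mult_ac)
  also have "\<dots> = - (s ^ 6 * d * (240 + 3600 * y\<^sup>2 + 3600 * y ^ 4 + 240 * y ^ 6)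
       + s ^ 5 * c * (1680 * y + 5040 * y ^ 3 + 1008 * y ^ 5 - 48 * y ^ 7)
       + s ^ 4 * b * (360 + 4560 * y\<^sup>2 + 2880 * y ^ 4 - 144 * y ^ 6 + 24 * y ^ 8)
       + s ^ 3 * a * (2520 * y + 5040 * y ^ 3 + 144 * y ^ 7 - 24 * y ^ 9))"
    unfolding L3 L4 L5 L6 unfolding P_def N_def y_def by algebra
  finally show ?thesis unfolding sum w .
qed

text \<open>
  The right-hand side is the combination of these four polynomials with the rounded coefficients
  \<open>113/100\<close>, \<open>- 1/10\<close>, \<open>9/100\<close>, \<open>- 1/2\<close>. The left-hand side majorises the contribution of
  \<open>- ln (sin x / x)\<close>. The difference is close to a quartic, which is nonnegative by completing squares.
\<close>

lemma log_part_lower_bound: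
  fixes y :: real
  assumes y: "0 \<le> y" "y \<le> 61 / 100"
  shows "110 + 690 * y\<^sup>2 \<le> 113 / 100 * (240 + 3600 * y^2 + 3600 * y^4 + 240 * y^6)
    - 1 / 10 * (1680 * y + 5040 * y^3 + 1008 * y^5 - 48 * y^7)
    + 9 / 100 * (360 + 4560 * y^2 + 2880 * y^4 - 144 * y^6 + 24 * y^8)
    - 1 / 2 * (2520 * y + 5040 * y^3 + 144 * y^7 - 24 * y^9)"
proof -
  have "0 \<le> 4265 * (y\<^sup>2 - 355 / 1000 * y)\<^sup>2 + 3250 * (y - 714 / 3250)\<^sup>2
     + (1936 / 10 - 714\<^sup>2 / 3250) + 903375 / 1000000 * y\<^sup>2 + 415 / 100 * y ^ 3
     + y ^ 4 * (622 / 10 - 1008 / 10 * y)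
     + y ^ 6 * (25824 / 100 - 672 / 10 * y + 216 / 100 * y\<^sup>2 + 12 * y ^ 3)"
  proof -
    have "0 \<le> 622 / 10 - 1008 / 10 * y" "0 \<le> 25824 / 100 - 672 / 10 * y" using y by auto
    then show ?thesis using y by (intro add_nonneg_nonneg mult_nonneg_nonneg) auto
  qed
  also have "\<dots> = 113 / 100 * (240 + 3600 * y^2 + 3600 * y^4 + 240 * y^6)
    - 1 / 10 * (1680 * y + 5040 * y^3 + 1008 * y^5 - 48 * y^7)
    + 9 / 100 * (360 + 4560 * y^2 + 2880 * y^4 - 144 * y^6 + 24 * y^8)
    - 1 / 2 * (2520 * y + 5040 * y^3 + 144 * y^7 - 24 * y^9) - (110 + 690 * y\<^sup>2)"
    by (simp add: algebra_simps eval_nat_numeral)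
  finally show ?thesis by simp
qed

text \<open>
  Comparison with the series for \<open>\<pi>\<^sup>2 / 6\<close>: four of the six factors \<open>w + k\<close> are at least \<open>3/2\<close>, the
  other two at least \<open>k + 1\<close>.
\<close>

lemma Polygamma_5_le:
  fixes w :: real
  assumes "w \<ge> 3 / 2"
  shows "Polygamma 5 w \<le> 40"
proof -
  have w: "w > 0" using assms by simp
  have "(\<lambda>k. 1 / (real k + 1)\<^sup>2) sums (pi\<^sup>2 / 6)"
    using inverse_squares_sums by (simp add: add.commute)
  from sums_mult[OF this, of "16 / 81"]
  have s: "(\<lambda>k. 16 / 81 * (1 / (real k + 1)\<^sup>2)) sums (16 / 81 * (pi\<^sup>2 / 6))" .
  have le: "inverse ((w + real k) ^ 6) \<le> 16 / 81 * (1 / (real k + 1)\<^sup>2)" for k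
  proof -
    have "(3 / 2) ^ 4 * (real k + 1)\<^sup>2 \<le> (w + real k) ^ 4 * (w + real k)\<^sup>2"
      using assms by (intro mult_mono power_mono) auto
    also have "\<dots> = (w + real k) ^ 6" by (simp flip: power_add)
    finally have "inverse ((w + real k) ^ 6) \<le> inverse ((3 / 2) ^ 4 * (real k + 1)\<^sup>2)"
      by (intro le_imp_inverse_le) (auto intro!: add_nonneg_pos)
    also have "\<dots> = 16 / 81 * (1 / (real k + 1)\<^sup>2)"
      unfolding inverse_mult_distrib by (simp add: power_divide inverse_eq_divide)
    finally show ?thesis .
  qed
  have "summable (\<lambda>k. inverse ((w + real k) ^ 6))"
    using w by (intro Polygamma_converges') auto
  then have "(\<Sum>k. inverse ((w + real k) ^ 6)) \<le> 16 / 81 * (pi\<^sup>2 / 6)"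
    by (intro sums_le[OF le _ s] summable_sums)
  also have "\<dots> \<le> 1 / 3"
  proof -
    have "pi\<^sup>2 \<le> (3.1416)\<^sup>2" using pi_approx by (intro power_mono) auto
    then show ?thesis by (simp add: power2_eq_square)
  qed
  finally have "(\<Sum>k. inverse ((w + real k) ^ 6)) \<le> 1 / 3" .
  then show ?thesis
    by (simp add: Polygamma_def fact_numeral)
qed

text \<open>
  The recurrence of the polygamma function splits off the terms with the nearest poles
  \<open>z = \<plusminus>1\<close>; the remainder has arguments at least \<open>3/2\<close>.
\<close>

lemma Polygamma_5_sum_le:
  fixes z :: real
  assumes "0 \<le> z" "z \<le> 1 / 2"
  shows "Polygamma 5 (1 + z) + Polygamma 5 (1 - z) \<le> 120 / (1 - z) ^ 6 + 120 / (1 + z) ^ 6 + 80"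
proof -
  have "Polygamma 5 (1 + z) = Polygamma 5 (2 + z) + 120 / (1 + z) ^ 6"
    using Polygamma_plus1[of "1 + z" 5] assms by (simp add: fact_numeral)
  moreover have "Polygamma 5 (1 - z) = Polygamma 5 (2 - z) + 120 / (1 - z) ^ 6"
    using Polygamma_plus1[of "1 - z" 5] assms by (simp add: fact_numeral)
  moreover have "Polygamma 5 (2 + z) \<le> 40" "Polygamma 5 (2 - z) \<le> 40"
    using assms by (intro Polygamma_5_le; simp)+
  ultimately show ?thesis by linarith
qed

text \<open>
  The factor \<open>(1 - y\<^sup>2) ^ 6\<close> almost cancels the growth of the two poles. In \<open>Y = y\<^sup>2\<close> the quotient
  \<open>(1 - Y) / (36/25 - Y)\<close> is concave and so lies below its tangent at \<open>0\<close>.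
  With the sixth power of the tangent replaced by its expansion to second order, an upper bound, a
  polynomial of degree five in \<open>Y\<close> remains to be compared with a linear one.
\<close>

lemma nearest_poles_bound:
  fixes y :: real
  assumes y: "0 \<le> y" "y \<le> 61 / 100"
  shows "(1 - y\<^sup>2) ^ 6 * (120 / (6/5 - y) ^ 6 + 120 / (6/5 + y) ^ 6) \<le> 81 + 690 * y\<^sup>2"
proof -
  define Y where "Y = y\<^sup>2"
  have Y: "0 \<le> Y" "Y \<le> 38 / 100"
    using power_mono[OF y(2) y(1), of 2] by (auto simp: Y_def power2_eq_square)
  \<comment> \<open>\<open>q\<close> collects the factor \<open>1 - y\<^sup>2\<close> over the product of the two pole factors.\<close>
  define q where "q = (1 - Y) / (36 / 25 - Y)"
  have pos: "36 / 25 - Y > 0" using Y by simp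
  have "25 / 36 * (1 - 11 / 36 * Y) * (36 / 25 - Y) = 1 - Y + 275 / 1296 * Y\<^sup>2"
    by algebra
  then have q: "0 \<le> q" "q \<le> 25 / 36 * (1 - 11 / 36 * Y)"
    unfolding q_def pos_divide_le_eq[OF pos] using Y pos by simp_all
  have pos': "6/5 - y > 0" "6/5 + y > 0" using y by auto
  have "1 - y\<^sup>2 = q * ((6/5 - y) * (6/5 + y))"
  proof -
    have "(6/5 - y) * (6/5 + y) = 36 / 25 - Y" unfolding Y_def by algebra
    then show ?thesis using pos by (simp add: q_def Y_def)
  qed
  then have "(1 - y\<^sup>2) ^ 6 * (120 / (6/5 - y) ^ 6 + 120 / (6/5 + y) ^ 6)
      = 120 * q ^ 6 * ((6/5 + y) ^ 6 + (6/5 - y) ^ 6)"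
  proof -
    have "120 * (A * B) ^ 6 / A ^ 6 = 120 * B ^ 6" "120 * (A * B) ^ 6 / B ^ 6 = 120 * A ^ 6"
      if "A > 0" "B > 0" for A B :: real
      using that by (simp_all add: power_mult_distrib)
    from this[OF pos'] show ?thesis
      unfolding \<open>1 - y\<^sup>2 = _\<close> power_mult_distrib[of q] by (simp add: algebra_simps)
  qed
  also have "(6/5 + y) ^ 6 + (6/5 - y) ^ 6
      = 2 * ((6/5) ^ 6 + 15 * (6/5) ^ 4 * Y + 15 * (6/5)\<^sup>2 * Y\<^sup>2 + Y ^ 3)"
    unfolding Y_def by algebra
  also have "120 * q ^ 6 * (2 * ((6/5) ^ 6 + 15 * (6/5) ^ 4 * Y + 15 * (6/5)\<^sup>2 * Y\<^sup>2 + Y ^ 3))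
      \<le> 120 * ((25/36) ^ 6 * (1 - 6 * (11/36 * Y) + 15 * (11/36 * Y)\<^sup>2)) *
        (2 * ((6/5) ^ 6 + 15 * (6/5) ^ 4 * Y + 15 * (6/5)\<^sup>2 * Y\<^sup>2 + Y ^ 3))"
  proof -
    define t where "t = 11 / 36 * Y"
    have t: "0 \<le> t" "t \<le> 1" using Y by (auto simp: t_def)
    have "q ^ 6 \<le> (25/36 * (1 - t)) ^ 6"
      using q by (intro power_mono) (auto simp: t_def)
    also have "\<dots> = (25/36) ^ 6 * (1 - t) ^ 6" by (rule power_mult_distrib)
    also have "(1 - t) ^ 6 = 1 - 6 * t + 15 * t\<^sup>2 - t ^ 3 * (5 + 15 * (1 - t) + 5 * t\<^sup>2 + t\<^sup>2 * (1 - t))"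
      by algebra
    also have "(25/36) ^ 6 * \<dots> \<le> (25/36) ^ 6 * (1 - 6 * t + 15 * t\<^sup>2)"
      using t by (intro mult_left_mono) (auto intro!: mult_nonneg_nonneg add_nonneg_nonneg)
    finally show ?thesis
      using Y unfolding t_def by (intro mult_right_mono mult_left_mono) auto
  qed
  also have "\<dots> = 240 * (25/36) ^ 3 *
      (1 + 103 / 12 * Y - Y\<^sup>2 * (565/54 - 19375/11664 * Y - 5328125/559872 * Y\<^sup>2 - 9453125/20155392 * Y ^ 3))"
    by (simp add: field_simps eval_nat_numeral)
  also have "\<dots> \<le> 240 * (25/36) ^ 3 * (1 + 103 / 12 * Y)"
  proof -
    have "Y\<^sup>2 \<le> 1" "Y ^ 3 \<le> 1" using Y by (auto intro: power_le_one)
    then have "0 \<le> Y\<^sup>2 * (565/54 - 19375/11664 * Y - 5328125/559872 * Y\<^sup>2 - 9453125/20155392 * Y ^ 3)"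
      using Y power_mono[of Y "38/100" 2] by (intro mult_nonneg_nonneg) (auto simp: power2_eq_square)
    then show ?thesis by (intro mult_left_mono) auto
  qed
  also have "\<dots> \<le> 81 + 690 * Y" using Y by (simp add: power3_eq_cube)
  finally show ?thesis by (simp add: Y_def)
qed

text \<open>
  Multiplied by \<open>(1 - y\<^sup>2) ^ 6 / s ^ 6\<close> with \<open>y = s x\<close>, the part with the logarithm is at most
  \<open>- (110 + 690 y\<^sup>2)\<close>. The part from \<open>- ln (sin x / x)\<close> is less than \<open>108 + 690 y\<^sup>2\<close>: its poles sit at
  \<open>y = \<plusminus>s \<pi>\<close>, and moving them inwards to \<open>\<plusminus>6/5\<close> only increases it.
\<close>

lemma gap_sixth_derivative_neg:
  fixes s x :: real
  assumes s: "s > 0" "s * pi \<ge> 6 / 5" and x: "0 \<le> x" "x \<le> pi / 2" "s * x \<le> 61 / 100"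
    and coeffs: "a \<ge> - 1 / 2 * s ^ 3" "b \<ge> 9 / 100 * s\<^sup>2" "c \<ge> - 1 / 10 * s" "d \<ge> 113 / 100"
  shows "gap_tower a b c d s 6 x < 0"
proof -
  define y where "y = s * x"
  have y: "0 \<le> y" "y \<le> 61 / 100" using s x by (auto simp: y_def)
  define w where "w = (1 - y\<^sup>2) ^ 6"
  have "y\<^sup>2 < 1" using power_strict_mono[of y 1 2] y by simp
  then have w: "w > 0" "w \<le> 1" by (auto simp: w_def intro!: power_le_one)
  define T0 T1 T2 T3 where T: "T0 = 240 + 3600 * y\<^sup>2 + 3600 * y ^ 4 + 240 * y ^ 6"
    "T1 = 1680 * y + 5040 * y ^ 3 + 1008 * y ^ 5 - 48 * y ^ 7"
    "T2 = 360 + 4560 * y\<^sup>2 + 2880 * y ^ 4 - 144 * y ^ 6 + 24 * y ^ 8"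
    "T3 = 2520 * y + 5040 * y ^ 3 + 144 * y ^ 7 - 24 * y ^ 9"
  have m: "y ^ 7 \<le> y ^ 5" "y ^ 6 \<le> y ^ 4" "y ^ 9 \<le> y ^ 7"
    using y by (auto intro!: power_decreasing)
  have Tpos: "T0 \<ge> 0" using y by (auto simp: T intro!: add_nonneg_nonneg)
  have nn: "0 \<le> y ^ k" for k using y by simp
  have Tpos': "T1 \<ge> 0" "T2 \<ge> 0" "T3 \<ge> 0"
    unfolding T using y m nn[of 2] nn[of 3] nn[of 4] nn[of 5] nn[of 6] nn[of 7] nn[of 8] by linarith+
  have "w * (\<Sum>j\<le>6. real (6 choose j) * (cubic_tower a b c d j x * reflected_sum ln_tower s (6 - j) x))
      = - (s ^ 6 * d * T0 + s ^ 5 * c * T1 + s ^ 4 * b * T2 + s ^ 3 * a * T3)"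
    using sixth_derivative_cubic_times_log[of s x a b c d] y unfolding w_def T y_def[symmetric] by simp
  also have "s ^ 6 * (113 / 100) * T0 \<le> s ^ 6 * d * T0"
    using s coeffs Tpos by (intro mult_right_mono mult_left_mono) auto
  then have "- (s ^ 6 * d * T0 + s ^ 5 * c * T1 + s ^ 4 * b * T2 + s ^ 3 * a * T3)
     \<le> - (s ^ 6 * (113 / 100) * T0 + s ^ 5 * (- 1 / 10 * s) * T1 + s ^ 4 * (9 / 100 * s\<^sup>2) * T2
         + s ^ 3 * (- 1 / 2 * s ^ 3) * T3)"
    using s coeffs Tpos Tpos'
    by (intro le_imp_neg_le add_mono mult_right_mono mult_left_mono) auto
  also have "\<dots> = - (s ^ 6 * (113 / 100 * T0 - 1 / 10 * T1 + 9 / 100 * T2 - 1 / 2 * T3))"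
    by algebra
  also have "\<dots> \<le> - (s ^ 6 * (110 + 690 * y\<^sup>2))"
    using log_part_lower_bound[OF y] s unfolding T by (intro le_imp_neg_le mult_left_mono) auto
  finally have log_part: "w * (\<Sum>j\<le>6. real (6 choose j) *
      (cubic_tower a b c d j x * reflected_sum ln_tower s (6 - j) x)) \<le> - (s ^ 6 * (110 + 690 * y\<^sup>2))" .

  define \<rho> where "\<rho> = s * pi"
  have \<rho>: "\<rho> \<ge> 6 / 5" using s by (simp add: \<rho>_def)
  have z: "x / pi = y / \<rho>" using s by (simp add: y_def \<rho>_def)
  have pi: "1 / pi = s / \<rho>" using s by (simp add: \<rho>_def)
  have "reflected_sum lgamma_tower (1 / pi) 6 x = (1 / pi) ^ 6 * (Polygamma 5 (1 + x / pi) + Polygamma 5 (1 - x / pi))"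
    by (simp add: reflected_sum_def lgamma_tower_def algebra_simps)
  also have "\<dots> \<le> (1 / pi) ^ 6 * (120 / (1 - x / pi) ^ 6 + 120 / (1 + x / pi) ^ 6 + 80)"
    using x by (intro mult_left_mono Polygamma_5_sum_le) (auto simp: field_simps)
  also have "\<dots> = s ^ 6 * (120 / (\<rho> - y) ^ 6 + 120 / (\<rho> + y) ^ 6 + 80 / \<rho> ^ 6)"
  proof -
    have "1 - y / \<rho> = (\<rho> - y) / \<rho>" "1 + y / \<rho> = (\<rho> + y) / \<rho>" using \<rho> by (auto simp: field_simps)
    then show ?thesis using \<rho> y unfolding z pi by (simp add: power_divide distrib_left)
  qed
  also have "\<dots> \<le> s ^ 6 * (120 / (6/5 - y) ^ 6 + 120 / (6/5 + y) ^ 6 + 80 / (6/5) ^ 6)"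
    using \<rho> y s by (intro mult_left_mono add_mono divide_left_mono power_mono mult_pos_pos zero_less_power) auto
  finally have "w * reflected_sum lgamma_tower (1 / pi) 6 x
      \<le> w * (s ^ 6 * (120 / (6/5 - y) ^ 6 + 120 / (6/5 + y) ^ 6 + 80 / (6/5) ^ 6))"
    using w by (intro mult_left_mono) auto
  also have "\<dots> = s ^ 6 * (w * (120 / (6/5 - y) ^ 6 + 120 / (6/5 + y) ^ 6) + w * (80 / (6/5) ^ 6))"
    by (simp only: algebra_simps)
  also have "\<dots> \<le> s ^ 6 * ((81 + 690 * y\<^sup>2) + 1 * (80 / (6/5) ^ 6))"
    using nearest_poles_bound[OF y] w s unfolding w_def[symmetric]
    by (intro mult_left_mono add_mono mult_right_mono) auto
  also have "\<dots> < s ^ 6 * (110 + 690 * y\<^sup>2)"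
    using s by (intro mult_strict_left_mono) (auto simp: eval_nat_numeral)
  finally have "w * gap_tower a b c d s 6 x < 0"
    using log_part unfolding gap_tower_def distrib_left by linarith
  then show ?thesis using w by (simp add: mult_less_0_iff)
qed

section \<open>The contact conditions at the endpoints\<close>

text \<open>
  Both logarithms are even in \<open>x\<close> and vanish at \<open>0\<close>; their second derivatives there are
  \<open>- 2 s\<^sup>2\<close> and \<open>2 / \<pi>\<^sup>2 * Polygamma 1 1 = 1 / 3\<close>. A triple zero at \<open>0\<close> therefore fixes \<open>d\<close>.
\<close>

lemma gap_at_0:
  "gap_tower a b c d s 0 0 = 0" "gap_tower a b c d s 1 0 = 0"
  "gap_tower a b c d s 2 0 = 1 / 3 - 2 * s\<^sup>2 * d"
proof -
  have "Polygamma 1 (1 :: real) = (\<Sum>k. inverse ((1 + real k)\<^sup>2))"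
    by (simp add: Polygamma_def numeral_2_eq_2)
  also have "\<dots> = (\<Sum>n. 1 / real ((n + 1)\<^sup>2))"
    by (intro suminf_cong) (simp add: inverse_eq_divide add.commute)
  finally have "Polygamma 1 (1 :: real) = pi\<^sup>2 / 6"
    using sums_unique[OF inverse_squares_sums] by simp
  then show "gap_tower a b c d s 0 0 = 0" "gap_tower a b c d s 1 0 = 0"
    "gap_tower a b c d s 2 0 = 1 / 3 - 2 * s\<^sup>2 * d"
    by (simp_all add: gap_tower_def cubic_tower_def reflected_sum_def ln_tower_def lgamma_tower_def
        numeral_2_eq_2 power2_eq_square ln_Gamma_real_pos)
qed

text \<open>
  At \<open>\<pi> / 2\<close> one has \<open>1 - s\<^sup>2 x\<^sup>2 = 2 / \<pi> = sin x / x\<close>, so both logarithms equal \<open>- ln (\<pi> / 2)\<close> there.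
\<close>

lemma gap_at_half_pi:
  fixes s :: real
  assumes s: "s > 0" "s\<^sup>2 = 4 * (pi - 2) / pi ^ 3"
  shows "gap_tower a b c d s 0 (pi / 2) = (1 - cubic_tower a b c d 0 (pi / 2)) * ln (pi / 2)"
    and "gap_tower a b c d s 1 (pi / 2) = 2 / pi - cubic_tower a b c d 1 (pi / 2) * ln (pi / 2)
      - cubic_tower a b c d 0 (pi / 2) * (2 * (pi - 2) / pi)"
    and "gap_tower a b c d s 2 (pi / 2) = 1 - 4 / pi\<^sup>2 - cubic_tower a b c d 2 (pi / 2) * ln (pi / 2)
      - 2 * cubic_tower a b c d 1 (pi / 2) * (2 * (pi - 2) / pi)
      - cubic_tower a b c d 0 (pi / 2) * (4 * (pi - 2) * (pi - 1) / pi\<^sup>2)"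
proof -
  define y where "y = s * (pi / 2)"
  have y2: "y\<^sup>2 = (pi - 2) / pi"
    unfolding y_def power_mult_distrib s(2) by (simp add: power_divide field_simps eval_nat_numeral)
  have "y > 0" using s by (simp add: y_def)
  moreover have "y\<^sup>2 < 1" unfolding y2 by (simp add: field_simps)
  ultimately have y: "0 < y" "y < 1" by (auto simp: power_less_one_iff)
  have y2': "1 - y\<^sup>2 = 2 / pi" "1 + y\<^sup>2 = 2 * (pi - 1) / pi"
    unfolding y2 by (simp_all add: field_simps)
  have s': "s = y * (2 / pi)" by (simp add: y_def)
  have sum2: "s\<^sup>2 = y\<^sup>2 * (2 / pi)\<^sup>2" by (simp add: s' power_mult_distrib power_divide)
  let ?L = "\<lambda>k. reflected_sum ln_tower s k (pi / 2)"
  have L0: "?L 0 = - ln (pi / 2)"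
  proof -
    have "?L 0 = ln ((1 + y) * (1 - y))"
      using y by (simp add: reflected_sum_def ln_tower_def ln_mult y_def)
    also have "(1 + y) * (1 - y) = 2 / pi"
      using y2'(1) by (simp add: algebra_simps power2_eq_square)
    finally show ?thesis by (simp add: ln_div)
  qed
  have L1: "?L 1 = - (2 * (pi - 2) / pi)"
  proof -
    have "?L 1 = s * (1 / (1 + y) - 1 / (1 - y))"
      by (simp add: reflected_sum_def ln_tower_def y_def algebra_simps inverse_eq_divide)
    also have "\<dots> = s * (- 2 * y / (1 - y\<^sup>2))"
      using y y2'(1) by (simp add: field_simps power2_eq_square)
    also have "\<dots> = - (2 * y\<^sup>2)"
      unfolding y2' by (simp add: s' power2_eq_square)
    finally show ?thesis unfolding y2 by simp
  qed
  have L2: "?L 2 = - (4 * (pi - 2) * (pi - 1) / pi\<^sup>2)"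
  proof -
    have "?L 2 = - s\<^sup>2 * (1 / (1 + y)\<^sup>2 + 1 / (1 - y)\<^sup>2)"
      by (simp add: reflected_sum_def ln_tower_def y_def numeral_2_eq_2 algebra_simps inverse_eq_divide power_divide)
    also have "1 / (1 + y)\<^sup>2 + 1 / (1 - y)\<^sup>2 = ((1 - y)\<^sup>2 + (1 + y)\<^sup>2) / ((1 + y)\<^sup>2 * (1 - y)\<^sup>2)"
      using y by (simp add: add_divide_distrib)
    also have "(1 + y)\<^sup>2 * (1 - y)\<^sup>2 = (1 - y\<^sup>2)\<^sup>2" by algebra
    also have "(1 - y)\<^sup>2 + (1 + y)\<^sup>2 = 2 * (1 + y\<^sup>2)" by algebra
    finally have "?L 2 = - (y\<^sup>2 * (2 / pi)\<^sup>2) * (2 * (2 * (pi - 1) / pi) / (2 / pi)\<^sup>2)"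
      unfolding y2' sum2 .
    also have "\<dots> = - (y\<^sup>2 * (2 * (2 * (pi - 1) / pi)))"
    proof -
      have "A * q * (B / q) = A * B" if "q \<noteq> 0" for A B q :: real using that by simp
      from this[of "(2 / pi)\<^sup>2"] show ?thesis by simp
    qed
    also have "\<dots> = - (4 * (pi - 2) * (pi - 1) / pi\<^sup>2)"
      unfolding y2 by (simp add: power2_eq_square) algebra
    finally show ?thesis .
  qed
  let ?S = "\<lambda>k. reflected_sum lgamma_tower (1 / pi) k (pi / 2)"
  have S0: "?S 0 = ln (pi / 2)"
    using neg_log_sinc[of "pi / 2"] by (simp add: ln_div)
  have S1: "?S 1 = 2 / pi"
    using neg_log_sinc_derivatives(1)[of "pi / 2"] by simp
  have S2: "?S 2 = 1 - 4 / pi\<^sup>2"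
    using neg_log_sinc_derivatives(2)[of "pi / 2"] by (simp add: power_divide)
  note vals = L0 L1 L2 S0 S1 S2
  show "gap_tower a b c d s 0 (pi / 2) = (1 - cubic_tower a b c d 0 (pi / 2)) * ln (pi / 2)"
    unfolding gap_tower_def using vals by (simp add: algebra_simps)
  show "gap_tower a b c d s 1 (pi / 2) = 2 / pi - cubic_tower a b c d 1 (pi / 2) * ln (pi / 2)
      - cubic_tower a b c d 0 (pi / 2) * (2 * (pi - 2) / pi)"
  proof -
    have "gap_tower a b c d s 1 (pi / 2) = cubic_tower a b c d 0 (pi / 2) * ?L 1
        + cubic_tower a b c d 1 (pi / 2) * ?L 0 + ?S 1"
      by (simp add: gap_tower_def)
    then show ?thesis unfolding vals by (simp only: algebra_simps)
  qed
  show "gap_tower a b c d s 2 (pi / 2) = 1 - 4 / pi\<^sup>2 - cubic_tower a b c d 2 (pi / 2) * ln (pi / 2)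
      - 2 * cubic_tower a b c d 1 (pi / 2) * (2 * (pi - 2) / pi)
      - cubic_tower a b c d 0 (pi / 2) * (4 * (pi - 2) * (pi - 1) / pi\<^sup>2)"
  proof -
    have "gap_tower a b c d s 2 (pi / 2) = cubic_tower a b c d 0 (pi / 2) * ?L 2
        + 2 * cubic_tower a b c d 1 (pi / 2) * ?L 1 + cubic_tower a b c d 2 (pi / 2) * ?L 0 + ?S 2"
      by (simp add: gap_tower_def numeral_2_eq_2)
    then show ?thesis unfolding vals by (simp only: algebra_simps)
  qed
qed

text \<open>
  The three hypotheses \<open>e0\<close>, \<open>e1\<close>, \<open>e2\<close> prescribe the cubic and its first two derivatives at \<open>p / 2\<close>,
  for \<open>p = \<pi>\<close> and \<open>l = ln (\<pi> / 2)\<close>; they form a linear system for the other three coefficients once \<open>d\<close> is known. Solved in this shape,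
  as a polynomial of degree two in \<open>1 / l\<close> after division by \<open>l\<^sup>2\<close>, the system serves both the closed
  forms and the numerical bounds.
\<close>

lemma Hermite_conditions_solved:
  fixes p l a b c d :: real
  assumes p: "p > 2"
    and e0: "a * (p / 2) ^ 3 + b * (p / 2)\<^sup>2 + c * (p / 2) + d = 1"
    and e1: "(3 * a * (p / 2)\<^sup>2 + 2 * b * (p / 2) + c) * l = (6 - 2 * p) / p"
    and e2: "(6 * a * (p / 2) + 2 * b) * l\<^sup>2 =
         (- 4 * (p - 2) / p) * ((6 - 2 * p) / p) + (1 - 4 / p\<^sup>2 - 4 * (p - 2) * (p - 1) / p\<^sup>2) * l"
  shows "a * p ^ 3 * l\<^sup>2 = 8 * ((1 - d) * l\<^sup>2 - (3 - p) * l + (p - 3) * (p - 2) - 3 / 8 * (p - 2)\<^sup>2 * l)"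
    and "b * p\<^sup>2 * l\<^sup>2 = 4 * ((3 * d - 3) * l\<^sup>2 + 3 * (3 - p) * l - 2 * (p - 3) * (p - 2) + 3 / 4 * (p - 2)\<^sup>2 * l)"
    and "c * p * l\<^sup>2 = 2 * ((3 - 3 * d) * l\<^sup>2 - 2 * (3 - p) * l + (p - 3) * (p - 2) - 3 / 8 * (p - 2)\<^sup>2 * l)"
proof -
  have f1: "(3 * a * p ^ 3 / 4 + b * p\<^sup>2 + c * p) * l = 6 - 2 * p"
  proof -
    have "(3 * a * p ^ 3 / 4 + b * p\<^sup>2 + c * p) * l = p * ((3 * a * (p / 2)\<^sup>2 + 2 * b * (p / 2) + c) * l)"
      by (simp add: power_divide algebra_simps power2_eq_square power3_eq_cube)
    then show ?thesis unfolding e1 using p by simp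
  qed
  have f2: "(3 * a * p ^ 3 + 2 * b * p\<^sup>2) * l\<^sup>2 = - 4 * (p - 2) * (6 - 2 * p) + (p\<^sup>2 - 4 - 4 * (p - 2) * (p - 1)) * l"
  proof -
    have "(3 * a * p ^ 3 + 2 * b * p\<^sup>2) * l\<^sup>2 = p\<^sup>2 * ((6 * a * (p / 2) + 2 * b) * l\<^sup>2)"
      by (simp add: algebra_simps power2_eq_square power3_eq_cube)
    also have "\<dots> = - 4 * (p - 2) * (6 - 2 * p) + (p\<^sup>2 - 4 - 4 * (p - 2) * (p - 1)) * l"
      unfolding e2 using p by (simp add: field_simps power2_eq_square)
    finally show ?thesis .
  qed
  have f0: "a * p ^ 3 / 8 + b * p\<^sup>2 / 4 + c * p / 2 + d = 1"
    using e0 by (simp add: power_divide)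
  show "a * p ^ 3 * l\<^sup>2 = 8 * ((1 - d) * l\<^sup>2 - (3 - p) * l + (p - 3) * (p - 2) - 3 / 8 * (p - 2)\<^sup>2 * l)"
    and "b * p\<^sup>2 * l\<^sup>2 = 4 * ((3 * d - 3) * l\<^sup>2 + 3 * (3 - p) * l - 2 * (p - 3) * (p - 2) + 3 / 4 * (p - 2)\<^sup>2 * l)"
    and "c * p * l\<^sup>2 = 2 * ((3 - 3 * d) * l\<^sup>2 - 2 * (3 - p) * l + (p - 3) * (p - 2) - 3 / 8 * (p - 2)\<^sup>2 * l)"
    using f0 f1 f2 by algebra+
qed

lemma coefficients_closed_form:
  fixes p l a b c d :: real
  assumes p: "p > 2" and l: "l > 0"
    and d: "d = p ^ 3 / (24 * (p - 2))"
    and A: "a * p ^ 3 * l\<^sup>2 = 8 * ((1 - d) * l\<^sup>2 - (3 - p) * l + (p - 3) * (p - 2) - 3 / 8 * (p - 2)\<^sup>2 * l)"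
    and B: "b * p\<^sup>2 * l\<^sup>2 = 4 * ((3 * d - 3) * l\<^sup>2 + 3 * (3 - p) * l - 2 * (p - 3) * (p - 2) + 3 / 4 * (p - 2)\<^sup>2 * l)"
    and C: "c * p * l\<^sup>2 = 2 * ((3 - 3 * d) * l\<^sup>2 - 2 * (3 - p) * l + (p - 3) * (p - 2) - 3 / 8 * (p - 2)\<^sup>2 * l)"
  shows "a = ((- (p ^ 3) + 24 * p - 48) * l\<^sup>2 - 3 * (p - 2) * (3 * p\<^sup>2 - 20 * p + 36) * l
                + 24 * (p - 3) * (p - 2)\<^sup>2) / (3 * (p - 2) * p ^ 3 * l\<^sup>2)"
    and "b = ((p ^ 3 - 24 * p + 48) * l\<^sup>2 + 6 * (p - 2) * (p - 4)\<^sup>2 * l - 16 * (p - 3) * (p - 2)\<^sup>2)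
              / (2 * (p - 2) * p\<^sup>2 * l\<^sup>2)"
    and "c = ((- (p ^ 3) + 24 * p - 48) * l\<^sup>2 - (3 * p - 10) * (p - 6) * (p - 2) * l + 8 * (p - 3) * (p - 2)\<^sup>2)
              / (4 * p * (p - 2) * l\<^sup>2)"
proof -
  have d': "24 * (p - 2) * d = p ^ 3" using d p by simp
  have nz: "3 * (p - 2) * p ^ 3 * l\<^sup>2 \<noteq> 0" "2 * (p - 2) * p\<^sup>2 * l\<^sup>2 \<noteq> 0" "4 * p * (p - 2) * l\<^sup>2 \<noteq> 0"
    using p l by auto
  have "a * (3 * (p - 2) * p ^ 3 * l\<^sup>2) = (- (p ^ 3) + 24 * p - 48) * l\<^sup>2
      - 3 * (p - 2) * (3 * p\<^sup>2 - 20 * p + 36) * l + 24 * (p - 3) * (p - 2)\<^sup>2"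
    using A d' by algebra
  then show "a = ((- (p ^ 3) + 24 * p - 48) * l\<^sup>2 - 3 * (p - 2) * (3 * p\<^sup>2 - 20 * p + 36) * l
                + 24 * (p - 3) * (p - 2)\<^sup>2) / (3 * (p - 2) * p ^ 3 * l\<^sup>2)"
    by (rule iffD2[OF nonzero_eq_divide_eq[OF nz(1)]])
  have "b * (2 * (p - 2) * p\<^sup>2 * l\<^sup>2) = (p ^ 3 - 24 * p + 48) * l\<^sup>2 + 6 * (p - 2) * (p - 4)\<^sup>2 * l
      - 16 * (p - 3) * (p - 2)\<^sup>2"
    using B d' by algebra
  then show "b = ((p ^ 3 - 24 * p + 48) * l\<^sup>2 + 6 * (p - 2) * (p - 4)\<^sup>2 * l - 16 * (p - 3) * (p - 2)\<^sup>2)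
              / (2 * (p - 2) * p\<^sup>2 * l\<^sup>2)"
    by (rule iffD2[OF nonzero_eq_divide_eq[OF nz(2)]])
  have "c * (4 * p * (p - 2) * l\<^sup>2) = (- (p ^ 3) + 24 * p - 48) * l\<^sup>2
      - (3 * p - 10) * (p - 6) * (p - 2) * l + 8 * (p - 3) * (p - 2)\<^sup>2"
    using C d' by algebra
  then show "c = ((- (p ^ 3) + 24 * p - 48) * l\<^sup>2 - (3 * p - 10) * (p - 6) * (p - 2) * l + 8 * (p - 3) * (p - 2)\<^sup>2)
              / (4 * p * (p - 2) * l\<^sup>2)"
    by (rule iffD2[OF nonzero_eq_divide_eq[OF nz(3)]])
qed

section \<open>Numerical bounds for the coefficients\<close>

lemma ln_half_pi_bounds: "45158 / 100000 \<le> ln (pi / 2)" "ln (pi / 2) \<le> 45159 / 100000"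
proof -
  have "45158 / 100000 \<le> ln (1570796 / 1000000 :: real)"
    using ln_approx_bounds[of "1570796 / 1000000" 4] by (simp add: eval_nat_numeral)
  also have "\<dots> \<le> ln (pi / 2)" using pi_approx by (subst ln_le_cancel_iff) auto
  finally show "45158 / 100000 \<le> ln (pi / 2)" .
  have "ln (pi / 2) \<le> ln (1570797 / 1000000 :: real)" using pi_approx by (subst ln_le_cancel_iff) auto
  also have "\<dots> \<le> 45159 / 100000"
    using ln_approx_bounds[of "1570797 / 1000000" 4] by (simp add: eval_nat_numeral)
  finally show "ln (pi / 2) \<le> 45159 / 100000" .
qed

text \<open>
  After scaling by powers of \<open>\<pi> / 2\<close> each coefficient is a combination of \<open>d\<close> and the three products
  \<open>(\<pi> - 3) / l\<close>, \<open>(\<pi> - 3) (\<pi> - 2) / l\<^sup>2\<close> and \<open>(\<pi> - 2)\<^sup>2 / l\<close>, all positive, so bounds for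
  \<open>\<pi>\<close> and \<open>l\<close> multiply termwise. The number \<open>\<sigma> = s \<pi> / 2\<close>, with \<open>\<sigma>\<^sup>2 = (\<pi> - 2) / \<pi>\<close>, is the right endpoint
  of the interval in the variable \<open>y = s x\<close>.
\<close>

lemma coefficients_bounds:
  fixes s a b c d :: real
  defines "l \<equiv> ln (pi / 2)"
  assumes s: "s > 0" "s\<^sup>2 = 4 * (pi - 2) / pi ^ 3"
    and d: "d = pi ^ 3 / (24 * (pi - 2))"
    and A: "a * pi ^ 3 * l\<^sup>2 = 8 * ((1 - d) * l\<^sup>2 - (3 - pi) * l + (pi - 3) * (pi - 2) - 3 / 8 * (pi - 2)\<^sup>2 * l)"
    and B: "b * pi\<^sup>2 * l\<^sup>2 = 4 * ((3 * d - 3) * l\<^sup>2 + 3 * (3 - pi) * l - 2 * (pi - 3) * (pi - 2) + 3 / 4 * (pi - 2)\<^sup>2 * l)"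
    and C: "c * pi * l\<^sup>2 = 2 * ((3 - 3 * d) * l\<^sup>2 - 2 * (3 - pi) * l + (pi - 3) * (pi - 2) - 3 / 8 * (pi - 2)\<^sup>2 * l)"
  shows "a \<ge> - 1 / 2 * s ^ 3" "b \<ge> 9 / 100 * s\<^sup>2" "c \<ge> - 1 / 10 * s" "d \<ge> 113 / 100"
    and "6 / 5 \<le> s * pi" "s * (pi / 2) \<le> 603 / 1000"
proof -
  define p where "p = pi"
  have p: "3141592 / 1000000 \<le> p" "p \<le> 3141593 / 1000000"
    using pi_approx by (auto simp: p_def)
  define u where "u = 1 / l"
  have l: "45158 / 100000 \<le> l" "l \<le> 45159 / 100000"
    using ln_half_pi_bounds by (auto simp: l_def)
  have u: "22143 / 10000 \<le> u" "u \<le> 221445 / 100000"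
    using l by (auto simp: u_def field_simps)
  have ul: "u * l = 1" using l by (simp add: u_def)
  have d_bounds: "113168 / 100000 \<le> d" "d \<le> 11317 / 10000"
  proof -
    have "(3141592 / 1000000) ^ 3 \<le> p ^ 3" "p ^ 3 \<le> (3141593 / 1000000) ^ 3"
      using p by (auto intro!: power_mono)
    then show "113168 / 100000 \<le> d" "d \<le> 11317 / 10000"
      using p unfolding d p_def[symmetric] by (auto simp: field_simps eval_nat_numeral)
  qed
  then show "d \<ge> 113 / 100" by simp
  have "141592 / 1000000 * (22143 / 10000) \<le> (p - 3) * u"
      "(p - 3) * u \<le> 141593 / 1000000 * (221445 / 100000)"
    using p u by (intro mult_mono; simp)+
  then have m1: "31352 / 100000 \<le> (p - 3) * u" "(p - 3) * u \<le> 31356 / 100000" by simp_all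
  have "(141592 / 1000000) * (1141592 / 1000000) * (22143 / 10000)\<^sup>2 \<le> (p - 3) * (p - 2) * u\<^sup>2"
      "(p - 3) * (p - 2) * u\<^sup>2 \<le> (141593 / 1000000) * (1141593 / 1000000) * (221445 / 100000)\<^sup>2"
    using p u by (intro mult_mono power_mono mult_nonneg_nonneg; simp)+
  then have m2: "79254 / 100000 \<le> (p - 3) * (p - 2) * u\<^sup>2" "(p - 3) * (p - 2) * u\<^sup>2 \<le> 79266 / 100000"
    by (simp_all add: power_divide)
  have "(1141592 / 1000000)\<^sup>2 * (22143 / 10000) \<le> (p - 2)\<^sup>2 * u"
      "(p - 2)\<^sup>2 * u \<le> (1141593 / 1000000)\<^sup>2 * (221445 / 100000)"
    using p u by (intro mult_mono power_mono; simp)+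
  then have m3: "288574 / 100000 \<le> (p - 2)\<^sup>2 * u" "(p - 2)\<^sup>2 * u \<le> 288595 / 100000"
    by (simp_all add: power_divide)
  define \<sigma> where "\<sigma> = s * (p / 2)"
  have "\<sigma>\<^sup>2 = (p - 2) / p"
    using p s(2) unfolding \<sigma>_def p_def by (simp add: power_mult_distrib power_divide field_simps eval_nat_numeral)
  moreover have "(6028 / 10000)\<^sup>2 \<le> (p - 2) / p" "(p - 2) / p \<le> (603 / 1000)\<^sup>2"
    using p by (auto simp: le_divide_eq divide_le_eq power2_eq_square)
  ultimately have \<sigma>2: "(6028 / 10000)\<^sup>2 \<le> \<sigma>\<^sup>2" "\<sigma>\<^sup>2 \<le> (603 / 1000)\<^sup>2"
    by simp_all
  have "\<sigma> > 0" using s p by (simp add: \<sigma>_def)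
  then have \<sigma>: "6028 / 10000 \<le> \<sigma>" "\<sigma> \<le> 603 / 1000"
    using power2_le_imp_le[OF \<sigma>2(1)] power2_le_imp_le[OF \<sigma>2(2)] by simp_all
  show "6 / 5 \<le> s * pi" "s * (pi / 2) \<le> 603 / 1000"
    using \<sigma> by (auto simp: \<sigma>_def p_def)
  \<comment> \<open>Dividing the solved conditions by \<open>l\<^sup>2\<close> turns them into quadratics in \<open>u\<close>.\<close>
  have in_u: "X = k0 + k1 * u + k2 * u\<^sup>2" if "X * l\<^sup>2 = k0 * l\<^sup>2 + k1 * l + k2" for X k0 k1 k2
  proof -
    have "X = (X * l\<^sup>2) * u\<^sup>2" using l by (simp add: u_def power_divide)
    also have "\<dots> = k0 + k1 * u + k2 * u\<^sup>2"
      unfolding that using l by (simp add: u_def power_divide field_simps power2_eq_square)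
    finally show ?thesis .
  qed
  have "a * (p / 2) ^ 3 = (1 - d) + (p - 3) * u + (p - 3) * (p - 2) * u\<^sup>2 - 3 / 8 * ((p - 2)\<^sup>2 * u)"
    using in_u[of "a * p ^ 3" "8 * (1 - d)" "- 8 * (3 - p) - 3 * (p - 2)\<^sup>2" "8 * (p - 3) * (p - 2)"] A
    unfolding p_def[symmetric] power_divide by (simp add: algebra_simps)
  moreover have "\<dots> \<ge> - 1095 / 10000"
    using d_bounds m1 m2 m3 by linarith
  ultimately have "a * (p / 2) ^ 3 \<ge> - 1095 / 10000" by (simp only:)
  moreover have "2 * (1095 / 10000) \<le> \<sigma> ^ 3"
    using power_mono[OF \<sigma>(1), of 3] by (simp add: eval_nat_numeral)
  moreover have "(- 1 / 2 * s ^ 3) * (p / 2) ^ 3 = - 1 / 2 * \<sigma> ^ 3"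
    by (simp only: \<sigma>_def power_mult_distrib mult.assoc)
  ultimately have "a * (p / 2) ^ 3 \<ge> (- 1 / 2 * s ^ 3) * (p / 2) ^ 3" by linarith
  then show "a \<ge> - 1 / 2 * s ^ 3" using p by (subst (asm) mult_le_cancel_right) auto
  have "b * (p / 2)\<^sup>2 = (3 * d - 3) - 3 * ((p - 3) * u) - 2 * ((p - 3) * (p - 2) * u\<^sup>2) + 3 / 4 * ((p - 2)\<^sup>2 * u)"
    using in_u[of "b * p\<^sup>2" "12 * d - 12" "12 * (3 - p) + 3 * (p - 2)\<^sup>2" "- 8 * (p - 3) * (p - 2)"] B
    unfolding p_def[symmetric] power_divide by (simp add: algebra_simps)
  moreover have "\<dots> \<ge> 328 / 10000"
    using d_bounds m1 m2 m3 by linarith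
  ultimately have "b * (p / 2)\<^sup>2 \<ge> 328 / 10000" by (simp only:)
  moreover have "9 / 100 * \<sigma>\<^sup>2 \<le> 328 / 10000" using \<sigma>2(2) by (simp add: power2_eq_square)
  moreover have "(9 / 100 * s\<^sup>2) * (p / 2)\<^sup>2 = 9 / 100 * \<sigma>\<^sup>2"
    by (simp only: \<sigma>_def power_mult_distrib mult.assoc)
  ultimately have "b * (p / 2)\<^sup>2 \<ge> (9 / 100 * s\<^sup>2) * (p / 2)\<^sup>2" by linarith
  then show "b \<ge> 9 / 100 * s\<^sup>2" using p by (subst (asm) mult_le_cancel_right) auto
  have "c * (p / 2) = (3 - 3 * d) + 2 * ((p - 3) * u) + (p - 3) * (p - 2) * u\<^sup>2 - 3 / 8 * ((p - 2)\<^sup>2 * u)"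
    using in_u[of "c * p" "6 - 6 * d" "- 4 * (3 - p) - 3 / 4 * (p - 2)\<^sup>2" "2 * (p - 3) * (p - 2)"] C
    unfolding p_def[symmetric] by (simp add: algebra_simps)
  moreover have "\<dots> \<ge> - 602 / 10000"
    using d_bounds m1 m2 m3 by linarith
  ultimately have "c * (p / 2) \<ge> - 602 / 10000" by (simp only:)
  moreover have "(- 1 / 10 * s) * (p / 2) = - 1 / 10 * \<sigma>" by (simp only: \<sigma>_def mult.assoc)
  ultimately have "c * (p / 2) \<ge> (- 1 / 10 * s) * (p / 2)" using \<sigma>(1) by linarith
  then show "c \<ge> - 1 / 10 * s" using p by (subst (asm) mult_le_cancel_right) auto
qed

section \<open>The theorem\<close>

theorem theorem1:
  fixes \<alpha>\<^sub>1 \<beta>\<^sub>1 \<gamma>\<^sub>1 \<delta>\<^sub>1 :: real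
  assumes "(f1 \<alpha>\<^sub>1 \<beta>\<^sub>1 \<gamma>\<^sub>1 \<delta>\<^sub>1 \<longlongrightarrow> 0) (at_right 0)"
    and "(deriv (f1 \<alpha>\<^sub>1 \<beta>\<^sub>1 \<gamma>\<^sub>1 \<delta>\<^sub>1) \<longlongrightarrow> 0) (at_right 0)"
    and "(deriv (deriv (f1 \<alpha>\<^sub>1 \<beta>\<^sub>1 \<gamma>\<^sub>1 \<delta>\<^sub>1)) \<longlongrightarrow> 0) (at_right 0)"
    and "f1 \<alpha>\<^sub>1 \<beta>\<^sub>1 \<gamma>\<^sub>1 \<delta>\<^sub>1 (pi / 2) = 0"
    and "deriv (f1 \<alpha>\<^sub>1 \<beta>\<^sub>1 \<gamma>\<^sub>1 \<delta>\<^sub>1) (pi / 2) = 0"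
    and "deriv (deriv (f1 \<alpha>\<^sub>1 \<beta>\<^sub>1 \<gamma>\<^sub>1 \<delta>\<^sub>1)) (pi / 2) = 0"
  shows "\<alpha>\<^sub>1 = ((- (pi ^ 3) + 24 * pi - 48) * (ln (pi / 2))\<^sup>2
                - 3 * (pi - 2) * (3 * pi\<^sup>2 - 20 * pi + 36) * ln (pi / 2)
                + 24 * (pi - 3) * (pi - 2)\<^sup>2)
              / (3 * (pi - 2) * pi ^ 3 * (ln (pi / 2))\<^sup>2)
       \<and> \<beta>\<^sub>1 = ((pi ^ 3 - 24 * pi + 48) * (ln (pi / 2))\<^sup>2
                + 6 * (pi - 2) * (pi - 4)\<^sup>2 * ln (pi / 2)
                - 16 * (pi - 3) * (pi - 2)\<^sup>2)
              / (2 * (pi - 2) * pi\<^sup>2 * (ln (pi / 2))\<^sup>2)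
       \<and> \<gamma>\<^sub>1 = ((- (pi ^ 3) + 24 * pi - 48) * (ln (pi / 2))\<^sup>2
                - (3 * pi - 10) * (pi - 6) * (pi - 2) * ln (pi / 2)
                + 8 * (pi - 3) * (pi - 2)\<^sup>2)
              / (4 * pi * (pi - 2) * (ln (pi / 2))\<^sup>2)
       \<and> \<delta>\<^sub>1 = pi ^ 3 / (24 * (pi - 2))
       \<and> (\<forall>x\<in>{0<..<pi / 2}. f1 \<alpha>\<^sub>1 \<beta>\<^sub>1 \<gamma>\<^sub>1 \<delta>\<^sub>1 x > 0)"
proof -
  define s where "s = sqrt (4 * (pi - 2) / pi ^ 3)"
  have pi: "3141592 / 1000000 \<le> pi" "pi \<le> 3141593 / 1000000" using pi_approx by simp_all
  then have s: "s > 0" "s\<^sup>2 = 4 * (pi - 2) / pi ^ 3" by (simp_all add: s_def)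
  have "s\<^sup>2 < (1 / 2)\<^sup>2"
  proof -
    have "3 ^ 3 \<le> pi ^ 3" using pi by (intro power_mono) auto
    then show ?thesis unfolding s(2) using pi by (simp add: field_simps power2_eq_square)
  qed
  then have s_half: "s < 1 / 2" by (rule power_less_imp_less_base) simp
  define G where "G = gap_tower \<alpha>\<^sub>1 \<beta>\<^sub>1 \<gamma>\<^sub>1 \<delta>\<^sub>1 s"
  \<comment> \<open>Since \<open>s < 1/2\<close> and \<open>\<pi> > 3\<close>, the interval \<open>(-2, 2)\<close> avoids all singularities of \<open>G\<close> and
    contains both endpoints \<open>0\<close> and \<open>\<pi> / 2\<close>.\<close>
  have G: "derivative_tower G {- 2<..<2}"
  proof (unfold G_def, rule derivative_tower_subset[OF derivative_tower_gap], intro subsetI CollectI conjI)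
    fix x :: real assume x: "x \<in> {- 2<..<2}"
    have "s * \<bar>x\<bar> < 1 / 2 * 2"
      using x s s_half by (intro mult_strict_mono) auto
    then show "\<bar>s * x\<bar> < 1" using s by (simp add: abs_mult)
    show "\<bar>x\<bar> < pi" using x pi by auto
  qed
  let ?U = "{0<..<2 :: real}"
  let ?B = "\<lambda>x :: real. sin x / x"
  let ?B1 = "\<lambda>x :: real. cos x / x - sin x / x\<^sup>2"
  let ?B2 = "\<lambda>x :: real. - sin x / x - 2 * cos x / x\<^sup>2 + 2 * sin x / x ^ 3"
  have f: "f1 \<alpha>\<^sub>1 \<beta>\<^sub>1 \<gamma>\<^sub>1 \<delta>\<^sub>1 x = ?B x * (exp (G 0 x) - 1)" if "x \<in> ?U" for x
  proof -
    have "s * x < 1 / 2 * 2" using that s s_half by (intro mult_strict_mono) auto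
    then show ?thesis using that pi s unfolding G_def by (intro f1_eq_sinc_mult_exp_gap) auto
  qed
  have B1: "(?B has_real_derivative ?B1 x) (at x)" if "x \<in> ?U" for x
    using that by (auto intro!: derivative_eq_intros simp: field_simps power2_eq_square)
  have B2: "(?B1 has_real_derivative ?B2 x) (at x)" if "x \<in> ?U" for x
    using that by (auto intro!: derivative_eq_intros simp: field_simps eval_nat_numeral)
  note f' = derivatives_mult_exp_minus_1[OF open_greaterThanLessThan derivative_tower_subset[OF G] B1 B2 f]
  have U: "?U \<subseteq> {- 2<..<2}" by auto
  note f' = f'[OF U]

  have h: "pi / 2 \<in> ?U" using pi by auto
  have G0_h: "G 0 (pi / 2) = 0" using assms(4) f[OF h] by simp
  have G1_h: "G 1 (pi / 2) = 0" using assms(5) f'(1)[OF _ _ _ h] G0_h by simp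
  have G2_h: "G 2 (pi / 2) = 0" using assms(6) f'(2)[OF _ _ _ h] G0_h G1_h by simp

  \<comment> \<open>At \<open>0\<close> the factor \<open>sin x / x\<close> tends to \<open>1\<close> and its first two derivatives stay bounded, so
    the limit of the second derivative of \<open>f1\<close> is the second derivative of \<open>G\<close>.\<close>
  have lim: "(G k \<longlongrightarrow> G k 0) (at_right 0)" for k
  proof -
    have "isCont (G k) 0" by (rule DERIV_isCont[OF derivative_towerD[OF G]]) auto
    then show ?thesis unfolding isCont_def filterlim_at_split by blast
  qed
  have lims: "(?B \<longlongrightarrow> 1) (at_right 0)" "(?B1 \<longlongrightarrow> 0) (at_right 0)" "(?B2 \<longlongrightarrow> - 1 / 3) (at_right 0)"
    by real_asymp+
  have lim1: "((\<lambda>x. ?B2 x * (exp (G 0 x) - 1) + 2 * (?B1 x * (exp (G 0 x) * G 1 x))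
      + ?B x * (exp (G 0 x) * ((G 1 x)\<^sup>2 + G 2 x))) \<longlongrightarrow>
      (- 1 / 3) * (exp (G 0 0) - 1) + 2 * (0 * (exp (G 0 0) * G 1 0))
      + 1 * (exp (G 0 0) * ((G 1 0)\<^sup>2 + G 2 0))) (at_right 0)"
    by (intro tendsto_intros lims lim)
  have ev: "\<forall>\<^sub>F x in at_right 0. deriv (deriv (f1 \<alpha>\<^sub>1 \<beta>\<^sub>1 \<gamma>\<^sub>1 \<delta>\<^sub>1)) x =
      ?B2 x * (exp (G 0 x) - 1) + 2 * (?B1 x * (exp (G 0 x) * G 1 x))
      + ?B x * (exp (G 0 x) * ((G 1 x)\<^sup>2 + G 2 x))"
  proof -
    have "\<forall>\<^sub>F x in at_right (0 :: real). x \<in> ?U" by (rule eventually_at_right_real) simp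
    then show ?thesis by eventually_elim (rule f'(2); assumption)
  qed
  have "(- 1 / 3) * (exp (G 0 0) - 1) + 2 * (0 * (exp (G 0 0) * G 1 0))
      + 1 * (exp (G 0 0) * ((G 1 0)\<^sup>2 + G 2 0)) = 0"
    by (rule tendsto_unique[OF trivial_limit_at_right_real lim1 assms(3)[unfolded tendsto_cong[OF ev]]])
  then have G2_0: "G 2 0 = 0" using gap_at_0 by (simp add: G_def)

  have \<delta>: "\<delta>\<^sub>1 = pi ^ 3 / (24 * (pi - 2))"
    using G2_0 pi unfolding G_def gap_at_0 s(2) by (simp add: field_simps)
  define l where "l = ln (pi / 2)"
  have l: "l > 0" unfolding l_def using ln_half_pi_bounds(1) by linarith
  have e0: "cubic_tower \<alpha>\<^sub>1 \<beta>\<^sub>1 \<gamma>\<^sub>1 \<delta>\<^sub>1 0 (pi / 2) = 1"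
    using G0_h l unfolding G_def gap_at_half_pi[OF s] by (simp add: l_def)
  have e1: "cubic_tower \<alpha>\<^sub>1 \<beta>\<^sub>1 \<gamma>\<^sub>1 \<delta>\<^sub>1 1 (pi / 2) * l = (6 - 2 * pi) / pi"
  proof -
    have "(6 - 2 * pi) / pi = 2 / pi - 2 * (pi - 2) / pi"
      by (simp add: algebra_simps flip: diff_divide_distrib)
    then show ?thesis using G1_h unfolding G_def gap_at_half_pi[OF s] e0 l_def by simp
  qed
  have e2: "cubic_tower \<alpha>\<^sub>1 \<beta>\<^sub>1 \<gamma>\<^sub>1 \<delta>\<^sub>1 2 (pi / 2) * l = - 4 * (pi - 2) / pi * cubic_tower \<alpha>\<^sub>1 \<beta>\<^sub>1 \<gamma>\<^sub>1 \<delta>\<^sub>1 1 (pi / 2)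
      + (1 - 4 / pi\<^sup>2 - 4 * (pi - 2) * (pi - 1) / pi\<^sup>2)"
  proof -
    have "- 4 * (pi - 2) / pi * X = - (2 * X * (2 * (pi - 2) / pi))" for X :: real
      by (simp add: divide_inverse algebra_simps)
    then show ?thesis
      using G2_h unfolding G_def gap_at_half_pi[OF s] e0 mult_1 l_def by simp
  qed
  have e2': "cubic_tower \<alpha>\<^sub>1 \<beta>\<^sub>1 \<gamma>\<^sub>1 \<delta>\<^sub>1 2 (pi / 2) * l\<^sup>2 = - 4 * (pi - 2) / pi * ((6 - 2 * pi) / pi)
      + (1 - 4 / pi\<^sup>2 - 4 * (pi - 2) * (pi - 1) / pi\<^sup>2) * l"
    using e2 e1 by (simp only: power2_eq_square mult.assoc[symmetric]) (simp only: distrib_right mult.assoc)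
  have "pi > 2" using pi by simp
  have scaled:
    "\<alpha>\<^sub>1 * pi ^ 3 * l\<^sup>2 = 8 * ((1 - \<delta>\<^sub>1) * l\<^sup>2 - (3 - pi) * l + (pi - 3) * (pi - 2) - 3 / 8 * (pi - 2)\<^sup>2 * l)"
    "\<beta>\<^sub>1 * pi\<^sup>2 * l\<^sup>2 = 4 * ((3 * \<delta>\<^sub>1 - 3) * l\<^sup>2 + 3 * (3 - pi) * l - 2 * (pi - 3) * (pi - 2) + 3 / 4 * (pi - 2)\<^sup>2 * l)"
    "\<gamma>\<^sub>1 * pi * l\<^sup>2 = 2 * ((3 - 3 * \<delta>\<^sub>1) * l\<^sup>2 - 2 * (3 - pi) * l + (pi - 3) * (pi - 2) - 3 / 8 * (pi - 2)\<^sup>2 * l)"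
    using e0 e1 e2' by (intro Hermite_conditions_solved[OF \<open>pi > 2\<close>]; simp add: cubic_tower_def)+
  note closed = coefficients_closed_form[OF \<open>pi > 2\<close> l \<delta> scaled]
  note bounds = coefficients_bounds[OF s \<delta> scaled[unfolded l_def]]

  have "f1 \<alpha>\<^sub>1 \<beta>\<^sub>1 \<gamma>\<^sub>1 \<delta>\<^sub>1 x > 0" if x: "x \<in> {0<..<pi / 2}" for x
  proof -
    have zero: "G k 0 = 0" "G k (pi / 2) = 0" if "k < 3" for k
    proof -
      have "k = 0 \<or> k = 1 \<or> k = 2" using that by linarith
      then show "G k 0 = 0" "G k (pi / 2) = 0"
        using G0_h G1_h G2_h G2_0 gap_at_0 by (auto simp: G_def)
    qed
    have "G 6 t < 0" if "0 < t" "t < pi / 2" for t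
    proof -
      have "s * t \<le> s * (pi / 2)" using that s by (intro mult_left_mono) auto
      then have "s * t \<le> 61 / 100" using bounds(6) by linarith
      with that show ?thesis
        unfolding G_def by (intro gap_sixth_derivative_neg[OF s(1) bounds(5) _ _ _ bounds(1-4)]) auto
    qed
    then have "G 0 x > 0"
      using x pi zero by (intro Hermite_sextic_pos[OF derivative_tower_subset[OF G], of 0 "pi / 2"]) auto
    moreover have "x \<in> ?U" "sin x > 0" using x pi by (auto intro!: sin_gt_zero)
    ultimately show ?thesis using f[of x] by simp
  qed
  with closed \<delta> show ?thesis unfolding l_def by blast
qed

end
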